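(* Let $q=p^e$ be a fixed prime power and $g\in\mathbb{F}_q[t,x]$ a fixed square-free polynomial with $\deg_x g=k$. Let $(n_j,m_j,N_j)$ be a sequence with $n_j\ge q$ and $m_j$ positive integers such that $m_j-p(\log_q n_j-\log_q\log_q n_j)\to\infty$, and $N_j\in\mathbb{F}_q[t]$ of degree $n_j$. Let $I(N_j,m_j)=\{N_j+a : a\in\mathbb{F}_q[t],\ \deg a<m_j\}$. Then, as $j\to\infty$, $$\#\{b\in I(N_j,m_j) : g(b)\text{ is square-free}\}=c_g\,q^{m_j}\,(1+o(1)).$$
   Context: $\mathbb{F}_q[t]$ is the polynomial ring over the finite field with $q$ elements; $\deg 0<m$ for every $m$. A polynomial in $\mathbb{F}_q[t]$ (resp. $\mathbb{F}_q[t,x]$) is square-free if it is nonzero and not divisible by the square of any non-constant polynomial. For $g\in\mathbb{F}_q[t,x]$ and $b\in\mathbb{F}_q[t]$, $g(b)=g(t,b(t))$. $\mathcal{P}$ denotes the set of monic irreducible polynomials in $\mathbb{F}_q[t]$; for nonzero $D$, $\|D\|=q^{\deg D}$ and $\rho_g(D)=\#\{a\bmod D: g(a)\equiv0\pmod D\}$; $c_g=\prod_{P\in\mathcal{P}}\left(1-\frac{\rho_g(P^2)}{\|P\|^2}\right)$. *)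

theory Defs
  imports
    "HOL-Analysis.Analysis"
    "HOL-Computational_Algebra.Squarefree"
    "HOL-Computational_Algebra.Polynomial"
    "HOL-Library.Landau_Symbols"
    "HOL-Number_Theory.Cong"
begin

text \<open>
  A type \<open>'a :: finite_field\<close> plays the role of \<open>F_q\<close>. Then \<open>F_q[t]\<close> is \<open>'a poly\<close>, and
  \<open>F_q[t,x]\<close> is \<open>'a poly poly\<close> with outer variable \<open>x\<close>: for \<open>g :: 'a poly poly\<close> and
  \<open>b :: 'a poly\<close> the specialisation \<open>g(b) = g(t, b(t))\<close> is \<open>poly g b\<close>, and \<open>degree g\<close> is
  the degree of \<open>g\<close> in \<open>x\<close>.

  Square-freeness is the library's \<^const>\<open>squarefree\<close>. It already excludes \<open>0\<close>, and the units
  it allows as square divisors are exactly the nonzero constants, as the next two lemmas record.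
\<close>

lemma squarefree_poly_iff:
  fixes f :: "'a::field poly"
  shows "squarefree f \<longleftrightarrow> f \<noteq> 0 \<and> (\<forall>h. (\<nexists>c. h = [:c:]) \<longrightarrow> \<not> h\<^sup>2 dvd f)"
proof -
  have "h dvd 1 \<longleftrightarrow> h \<noteq> 0 \<and> (\<exists>c. h = [:c:])" for h :: "'a poly"
    by (auto simp: is_unit_poly_iff dvd_field_iff)
  then show ?thesis
    by (auto simp: squarefree_def)
qed

lemma squarefree_poly_poly_iff:
  fixes g :: "'a::field poly poly"
  shows "squarefree g \<longleftrightarrow> g \<noteq> 0 \<and> (\<forall>h. (\<nexists>c. h = [:[:c:]:]) \<longrightarrow> \<not> h\<^sup>2 dvd g)"
proof -
  have "h dvd 1 \<longleftrightarrow> h \<noteq> 0 \<and> (\<exists>c. h = [:[:c:]:])" for h :: "'a poly poly"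
    by (auto simp: is_unit_poly_iff dvd_field_iff)
  then show ?thesis
    by (auto simp: squarefree_def)
qed

definition monic_irreducibles :: "'a::finite_field poly set" where
  "monic_irreducibles = {P. lead_coeff P = 1 \<and> irreducible P}"

text \<open>Only meaningful for nonzero \<open>D\<close>.\<close>

definition poly_norm :: "'a::finite_field poly \<Rightarrow> nat" where
  "poly_norm D = CARD('a) ^ degree D"

text \<open>Residue classes modulo \<open>D\<close> are identified with their remainders \<open>a mod D\<close>.\<close>

definition rho :: "'a::finite_field poly poly \<Rightarrow> 'a poly \<Rightarrow> nat" where
  "rho g D = card {a mod D | a. [poly g a = 0] (mod D)}"

text \<open>
  The infinite product over the (countable) set of monic irreducibles is the limit of the finite
  partial products along the finite subsets, the multiplicative analogue of \<^const>\<open>infsum\<close>.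
  All factors lie in \<open>[0,1]\<close>, so this limit exists (it is the infimum of the partial products);
  unlike with \<^const>\<open>prodinf\<close>, vanishing factors need no special treatment.
\<close>

definition density_const :: "'a::finite_field poly poly \<Rightarrow> real" where
  "density_const g =
     Lim (finite_subsets_at_top monic_irreducibles)
       (\<lambda>F. \<Prod>P\<in>F. 1 - real (rho g (P\<^sup>2)) / real (poly_norm P) ^ 2)"

text \<open>The zero polynomial counts as having degree below every \<open>m\<close>.\<close>

definition short_interval :: "'a::finite_field poly \<Rightarrow> nat \<Rightarrow> 'a poly set" where
  "short_interval N m = {N + a | a. a = 0 \<or> degree a < m}"

end

theory Submission
  imports Defs "HOL-Computational_Algebra.Polynomial_Factorial"
begin


text \<open>
  Sieve by the squares \<open>P\<^sup>2\<close> of monic irreducibles. The condition for the \<open>P\<close> with \<open>deg P \<le> d\<close> is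
  periodic, so the Chinese remainder theorem counts it exactly; for \<open>d < deg P \<le> m / 2\<close> a union bound
  with \<open>\<rho>(P\<^sup>2) \<le> deg g\<close> loses \<open>O(q\<^sup>m / q\<^sup>d)\<close>. For the large \<open>P\<close>, a square \<open>P\<^sup>2\<close> dividing \<open>g(b)\<close> forces \<open>P\<close>
  to divide \<open>g(b)\<close> and \<open>g(b)' = (g\<^sub>t + b' g\<^sub>x)(b)\<close>. As \<open>g\<close> is square-free, eliminating \<open>b\<close> gives a fixed
  \<open>S \<noteq> 0\<close> in \<open>F\<^sub>q[t][\<beta>]\<close> with \<open>P\<close> dividing \<open>S(b')\<close>. Since \<open>b'\<close> does not change under \<open>b \<mapsto> b + y\<^sup>p\<close>, for
  all these translates only the \<open>O(max n m / m)\<close> large prime divisors of \<open>S(b')\<close> matter, and each of them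
  is responsible for at most \<open>deg g\<close> values of \<open>y\<close>. As there are at least \<open>q\<close> to the power \<open>m / p\<close>
  values of \<open>y\<close>, averaging over the translates bounds the proportion of bad \<open>b\<close> by
  \<open>O(max n m / (m q powr (m / p)))\<close>, up to the \<open>b\<close> with \<open>S(b') = 0\<close>, and the hypothesis on \<open>m\<close>
  makes this \<open>o(1)\<close>.
\<close>

subsection \<open>Derivations of bivariate polynomials and perfectness\<close>

text \<open>The derivative in the inner variable \<open>t\<close>; \<open>pderiv\<close> itself
  differentiates in the outer variable \<open>x\<close>.\<close>

definition tderiv :: "'a::field poly poly \<Rightarrow> 'a poly poly" where
  "tderiv f = map_poly pderiv f"

lemma coeff_tderiv: "coeff (tderiv f) i = pderiv (coeff f i)"
  by (simp add: tderiv_def coeff_map_poly)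

lemma tderiv_0 [simp]: "tderiv 0 = 0"
  by (simp add: tderiv_def)

lemma tderiv_pCons: "tderiv (pCons a f) = pCons (pderiv a) (tderiv f)"
  by (rule poly_eqI) (simp add: coeff_tderiv coeff_pCons split: nat.splits)

lemma tderiv_add: "tderiv (f + g) = tderiv f + tderiv g"
  by (rule poly_eqI) (simp add: coeff_tderiv pderiv_add)

lemma tderiv_smult: "tderiv (smult a f) = smult a (tderiv f) + smult (pderiv a) f"
  by (rule poly_eqI) (simp add: coeff_tderiv pderiv_mult mult.commute)

lemma tderiv_mult: "tderiv (f * g) = f * tderiv g + g * tderiv f"
proof (induction f)
  case (pCons a f)
  have "tderiv (pCons a f * g) = tderiv (smult a g) + pCons 0 (tderiv (f * g))"
    by (simp add: tderiv_add tderiv_pCons)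
  also have "\<dots> = pCons a f * tderiv g + g * tderiv (pCons a f)"
    by (simp add: pCons.IH tderiv_smult tderiv_pCons algebra_simps)
  finally show ?case .
qed simp

lemma degree_tderiv_le: "degree (tderiv f) \<le> degree f"
  by (rule degree_le) (simp add: coeff_tderiv coeff_eq_0)

text \<open>The derivation \<open>\<partial>/\<partial>t + \<beta> \<partial>/\<partial>x\<close>, to be used with \<open>\<beta> = b'\<close>.\<close>

definition total_deriv :: "'a::field poly \<Rightarrow> 'a poly poly \<Rightarrow> 'a poly poly" where
  "total_deriv \<beta> f = tderiv f + smult \<beta> (pderiv f)"

lemma total_deriv_mult: "total_deriv \<beta> (f * g) = f * total_deriv \<beta> g + g * total_deriv \<beta> f"
  by (simp add: total_deriv_def tderiv_mult pderiv_mult algebra_simps smult_add_right)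

lemma pderiv_poly: "pderiv (poly f b) = poly (total_deriv (pderiv b) f) b"
  by (induction f) (simp_all add: total_deriv_def tderiv_pCons pderiv_pCons pderiv_add
      pderiv_mult algebra_simps)

lemma square_dvd_imp_dvd_pderiv:
  fixes P h :: "'a::field poly"
  assumes "P\<^sup>2 dvd h"
  shows "P dvd pderiv h"
proof -
  obtain u where "h = P * (P * u)"
    using assms by (metis dvdE power2_eq_square mult.assoc)
  then show ?thesis by (simp add: pderiv_mult)
qed

section \<open>Perfectness: vanishing derivatives and \<open>p\<close>-th powers\<close>

text \<open>The Frobenius is additive, hence injective, and an injective self-map of a finite set is
  onto.\<close>

lemma frobenius_surj: "\<exists>y. y ^ CHAR('a) = x" for x :: "'a::finite_field"
proof -
  have "inj (\<lambda>y::'a. y ^ CHAR('a))"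
  proof (rule injI)
    fix x y :: 'a assume eq: "x ^ CHAR('a) = y ^ CHAR('a)"
    have "x ^ CHAR('a) = ((x - y) + y) ^ CHAR('a)" by simp
    also have "\<dots> = (x - y) ^ CHAR('a) + y ^ CHAR('a)"
      by (rule freshmans_dream) auto
    finally show "x = y" using eq by simp
  qed
  then have "surj (\<lambda>y::'a. y ^ CHAR('a))" by (simp add: finite_UNIV_inj_surj)
  then show ?thesis by (metis surjD)
qed

lemma monom_power_eq: "monom (c::'b::comm_semiring_1) n ^ k = monom (c ^ k) (n * k)"
  by (induction k) (simp_all add: mult_monom monom_eq_1)

text \<open>A vanishing derivative kills every coefficient whose index is not a multiple of
  \<open>p\<close>, and additivity of the Frobenius takes the root of the remaining sum of
  \<open>p\<close>-th powers. Asking for \<open>p\<close>-th powers as coefficients, rather than for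
  a perfect coefficient ring, lets the lemma serve both over \<open>'a\<close> and over
  \<open>'a poly\<close>.\<close>

lemma power_CHAR_if_pderiv_eq_0:
  fixes f :: "'b::idom_prime_char poly"
  assumes "pderiv f = 0" and "\<And>i. \<exists>e. coeff f i = e ^ CHAR('b)"
  shows "\<exists>h. f = h ^ CHAR('b)"
proof -
  let ?p = "CHAR('b)"
  obtain e where e: "\<And>i. coeff f i = e i ^ ?p" using assms(2) by metis
  have zero: "coeff f i = 0" if "\<not> ?p dvd i" for i
  proof (cases i)
    case 0
    then show ?thesis using that by simp
  next
    case (Suc j)
    have "of_nat i * coeff f i = 0"
      using arg_cong[OF assms(1), of "\<lambda>p. coeff p j"] Suc by (simp add: coeff_pderiv del: of_nat_Suc)
    then show ?thesis using that by (simp add: of_nat_eq_0_iff_char_dvd)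
  qed
  define A where "A = {i. i \<le> degree f \<and> ?p dvd i}"
  have "f = (\<Sum>i\<le>degree f. monom (coeff f i) i)" by (simp add: poly_as_sum_of_monoms)
  also have "\<dots> = (\<Sum>i\<in>A. monom (coeff f i) i)"
    by (rule sum.mono_neutral_right) (auto simp: A_def zero)
  also have "\<dots> = (\<Sum>i\<in>A. monom (e i) (i div ?p) ^ ?p)"
    by (rule sum.cong) (auto simp: A_def monom_power_eq e)
  also have "\<dots> = (\<Sum>i\<in>A. monom (e i) (i div ?p)) ^ ?p"
    by (rule freshmans_dream_sum[symmetric]) auto
  finally show ?thesis by blast
qed

lemma power_CHAR_if_pderiv_eq_0_finite_field:
  fixes f :: "'a::finite_field poly"
  assumes "pderiv f = 0"
  shows "\<exists>h. f = h ^ CHAR('a)"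
  using power_CHAR_if_pderiv_eq_0[OF assms] frobenius_surj by metis

text \<open>Two passes: \<open>tderiv f = 0\<close> makes every coefficient a \<open>p\<close>-th
  power in \<open>t\<close>, and then \<open>pderiv f = 0\<close> makes \<open>f\<close> itself
  one.\<close>

lemma power_CHAR_if_derivs_eq_0:
  fixes f :: "'a::finite_field poly poly"
  assumes "pderiv f = 0" and "tderiv f = 0"
  shows "\<exists>h. f = h ^ CHAR('a)"
proof -
  have "\<exists>e. coeff f i = e ^ CHAR('a)" for i
    using assms(2) power_CHAR_if_pderiv_eq_0_finite_field by (metis coeff_tderiv coeff_0)
  then show ?thesis
    using power_CHAR_if_pderiv_eq_0[of f] assms(1) by simp
qed

subsection \<open>Elimination\<close>

lemma ex_prime_elem_dvd:
  fixes a :: "'a::field poly"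
  assumes "a \<noteq> 0" and "\<not> a dvd 1"
  shows "\<exists>P. prime_elem P \<and> P dvd a"
  using assms
proof (induction "degree a" arbitrary: a rule: less_induct)
  case less
  show ?case
  proof (cases "irreducible a")
    case True
    then show ?thesis using field_poly_irreducible_imp_prime dvd_refl by metis
  next
    case False
    then obtain b c where bc: "a = b * c" "\<not> b dvd 1" "\<not> c dvd 1"
      using less.prems by (auto simp: irreducible_def)
    have "b \<noteq> 0" "c \<noteq> 0" using bc less.prems by auto
    moreover have "degree c \<noteq> 0" using bc \<open>c \<noteq> 0\<close> by (simp add: is_unit_iff_degree)
    ultimately have "degree b < degree a" by (simp add: bc degree_mult_eq)
    from less.hyps[OF this \<open>b \<noteq> 0\<close> bc(2)] show ?thesis by (auto simp: bc)
  qed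
qed

text \<open>A form of Gauss's lemma: the prime factors \<open>P\<close> of \<open>a\<close> are
  removed one at a time. As \<open>[:P:]\<close> is prime, it either divides \<open>e\<close>, and
  then moves into the constant \<open>c\<close>, or divides both cofactors, and then cancels against
  \<open>a\<close>.\<close>

lemma common_divisor_clear_denominator:
  fixes e f h :: "'a::field poly poly" and a :: "'a poly"
  assumes "a \<noteq> 0" and "e \<noteq> 0" and "e dvd smult a f" and "e dvd smult a h"
  shows "\<exists>c d. c \<noteq> 0 \<and> e = smult c d \<and> d dvd f \<and> d dvd h"
  using assms
proof (induction "degree a" arbitrary: a e rule: less_induct)
  case less
  show ?case
  proof (cases "a dvd 1")
    case True
    then obtain a' where "a * a' = 1" by (metis dvdE)
    then have "smult a' (smult a f) = f" "smult a' (smult a h) = h" by (simp_all add: mult.commute)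
    then have "e dvd f" "e dvd h" using less.prems dvd_smult by metis+
    then show ?thesis by (intro exI[of _ 1] exI[of _ e]) simp
  next
    case False
    then obtain P where P: "prime_elem P" "P dvd a" using ex_prime_elem_dvd less.prems by blast
    from P(1) have P0: "P \<noteq> 0" "\<not> P dvd 1" by (auto simp: prime_elem_def)
    have Pp: "prime_elem [:P:]" using P(1) by (simp add: prime_elem_const_poly_iff)
    obtain a' where a': "a = P * a'" using P(2) by auto
    have a'0: "a' \<noteq> 0" using a' less.prems by auto
    have deg: "degree a' < degree a"
      using a' a'0 P0 by (simp add: degree_mult_eq is_unit_iff_degree)
    obtain w1 w2 where w: "smult a f = e * w1" "smult a h = e * w2"
      using less.prems by (auto elim!: dvdE)
    have "[:P:] * smult a' f = smult a f" "[:P:] * smult a' h = smult a h"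
      by (simp_all add: a' mult.commute)
    then have eq: "[:P:] * smult a' f = e * w1" "[:P:] * smult a' h = e * w2"
      using w by simp_all
    show ?thesis
    proof (cases "[:P:] dvd e")
      case True
      then obtain e1 where e1: "e = [:P:] * e1" by auto
      have "[:P:] * smult a' f = [:P:] * (e1 * w1)" "[:P:] * smult a' h = [:P:] * (e1 * w2)"
        using eq by (simp_all only: e1 mult.assoc)
      moreover have "[:P:] \<noteq> 0" using P0 by simp
      ultimately have "smult a' f = e1 * w1" "smult a' h = e1 * w2"
        using mult_left_cancel by blast+
      then have "e1 dvd smult a' f" "e1 dvd smult a' h" by simp_all
      moreover have "e1 \<noteq> 0" using e1 less.prems by auto
      ultimately obtain c d where cd: "c \<noteq> 0" "e1 = smult c d" "d dvd f" "d dvd h"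
        using less.hyps[OF deg a'0] by blast
      then show ?thesis using P0 e1 by (intro exI[of _ "P * c"] exI[of _ d]) (simp add: mult.commute)
    next
      case False
      have "[:P:] dvd e * w1" "[:P:] dvd e * w2" using eq by (metis dvd_triv_left)+
      then have "[:P:] dvd w1" "[:P:] dvd w2"
        using False Pp prime_elem_dvd_multD by blast+
      then obtain v1 v2 where v: "w1 = [:P:] * v1" "w2 = [:P:] * v2" by (auto elim!: dvdE)
      have "[:P:] * smult a' f = [:P:] * (e * v1)" "[:P:] * smult a' h = [:P:] * (e * v2)"
        using eq by (simp_all only: v mult.assoc mult.left_commute)
      moreover have "[:P:] \<noteq> 0" using P0 by simp
      ultimately have "smult a' f = e * v1" "smult a' h = e * v2"
        using mult_left_cancel by blast+
      then have "e dvd smult a' f" "e dvd smult a' h" by simp_all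
      then show ?thesis using less.hyps[OF deg a'0 less.prems(2)] by blast
    qed
  qed
qed

lemma pseudo_division:
  fixes f e :: "'b::idom poly"
  assumes "e \<noteq> 0"
  shows "\<exists>K q r. smult (lead_coeff e ^ K) f = e * q + r \<and> (r = 0 \<or> degree r < degree e)"
  using pseudo_divmod[OF assms, of f] by (metis surj_pair)

text \<open>Take a nonzero combination \<open>e\<close> of \<open>f\<close> and \<open>h\<close> of
  least degree in \<open>x\<close>. Pseudo-division by \<open>e\<close> leaves a remainder that is
  again a combination, hence zero, so \<open>e\<close> divides \<open>f\<close> and \<open>h\<close>
  up to powers of its leading coefficient. Clearing these denominators yields a true common divisor
  \<open>d\<close>, at the price of the factor \<open>c\<close>.\<close>

lemma bezout_up_to_constant:
  fixes f h :: "'a::field poly poly"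
  assumes "f \<noteq> 0"
  shows "\<exists>c d u v. c \<noteq> 0 \<and> u * f + v * h = smult c d \<and> d dvd f \<and> d dvd h"
proof -
  define I where "I = {e. e \<noteq> 0 \<and> (\<exists>u v. e = u * f + v * h)}"
  have "f \<in> I" using assms unfolding I_def by (auto intro: exI[of _ 1] exI[of _ 0])
  then obtain e where e: "e \<in> I" "\<And>e'. e' \<in> I \<Longrightarrow> degree e \<le> degree e'"
    using ex_has_least_nat[of "\<lambda>e. e \<in> I" f degree] by blast
  from e(1) obtain u v where uv: "e \<noteq> 0" "e = u * f + v * h" by (auto simp: I_def)
  have dvd: "\<exists>K. e dvd smult (lead_coeff e ^ K) (s * f + t * h)" for s t
  proof -
    obtain K q r where r: "smult (lead_coeff e ^ K) (s * f + t * h) = e * q + r"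
      "r = 0 \<or> degree r < degree e" using pseudo_division[OF uv(1)] by blast
    have "r = smult (lead_coeff e ^ K) (s * f + t * h) - e * q" using r(1) by simp
    also have "\<dots> = (smult (lead_coeff e ^ K) s - u * q) * f + (smult (lead_coeff e ^ K) t - v * q) * h"
      by (subst (2) uv(2)) (simp add: algebra_simps smult_add_right)
    finally have "r = 0 \<or> r \<in> I" by (auto simp: I_def)
    then have "r = 0" using r(2) e(2)[of r] by auto
    then show ?thesis using r(1) by (intro exI[of _ K]) simp
  qed
  obtain K L where K: "e dvd smult (lead_coeff e ^ K) f" and L: "e dvd smult (lead_coeff e ^ L) h"
    using dvd[of 1 0] dvd[of 0 1] by auto
  define a where "a = lead_coeff e ^ (K + L)"
  have "smult a f = smult (lead_coeff e ^ L) (smult (lead_coeff e ^ K) f)"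
    and "smult a h = smult (lead_coeff e ^ K) (smult (lead_coeff e ^ L) h)"
    by (simp_all add: a_def power_add mult.commute)
  then have "e dvd smult a f" "e dvd smult a h" using K L by (metis dvd_smult)+
  moreover have "a \<noteq> 0" using uv(1) by (simp add: a_def)
  ultimately show ?thesis
    using common_divisor_clear_denominator[of a e f h] uv by metis
qed

section \<open>Linear dependence and annihilating polynomials\<close>

text \<open>More vectors than coordinates: Gaussian elimination over a domain, where cross
  multiplication with the pivot entry \<open>a\<close> replaces division.\<close>

lemma linear_dependence:
  fixes w :: "'i \<Rightarrow> 'b::idom poly"
  assumes "finite I" and "card I > d" and "\<And>i j. i \<in> I \<Longrightarrow> j \<ge> d \<Longrightarrow> coeff (w i) j = 0"
  shows "\<exists>c. (\<exists>i\<in>I. c i \<noteq> 0) \<and> (\<Sum>i\<in>I. smult (c i) (w i)) = 0"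
  using assms
proof (induction d arbitrary: I w)
  case 0
  then have "w i = 0" if "i \<in> I" for i using that by (intro poly_eqI) simp
  moreover obtain i where "i \<in> I" using 0 by fastforce
  ultimately show ?case by (intro exI[of _ "\<lambda>_. 1"]) (auto intro!: sum.neutral)
next
  case (Suc d)
  show ?case
  proof (cases "\<forall>i\<in>I. coeff (w i) d = 0")
    case True
    then have "coeff (w i) j = 0" if "i \<in> I" "j \<ge> d" for i j
      using that Suc.prems(3)[of i j] by (cases "j = d") auto
    then show ?thesis using Suc.IH[of I w] Suc.prems by auto
  next
    case False
    then obtain k where k: "k \<in> I" "coeff (w k) d \<noteq> 0" by blast
    define a where "a = coeff (w k) d"
    define w' where "w' i = smult a (w i) - smult (coeff (w i) d) (w k)" for i
    have "coeff (w' i) j = 0" if "i \<in> I - {k}" "j \<ge> d" for i j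
      using that k Suc.prems(3)[of i j] Suc.prems(3)[of k j]
      by (cases "j = d") (auto simp: w'_def a_def)
    moreover have "card (I - {k}) > d" using k Suc.prems by simp
    ultimately obtain c where c: "\<exists>i\<in>I - {k}. c i \<noteq> 0"
      "(\<Sum>i\<in>I - {k}. smult (c i) (w' i)) = 0"
      using Suc.IH[of "I - {k}" w'] Suc.prems(1) by auto
    \<comment> \<open>The coefficient of the pivot vector collects all multiples of
      \<open>w k\<close> that were subtracted in forming the \<open>w' i\<close>.\<close>
    define c' where "c' i = (if i = k then - (\<Sum>i\<in>I - {k}. c i * coeff (w i) d) else c i * a)" for i
    have "(\<Sum>i\<in>I. smult (c' i) (w i)) = smult (c' k) (w k) + (\<Sum>i\<in>I - {k}. smult (c' i) (w i))"
      using Suc.prems(1) k(1) by (rule sum.remove)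
    also have "(\<Sum>i\<in>I - {k}. smult (c' i) (w i)) = (\<Sum>i\<in>I - {k}. smult (c i * a) (w i))"
      by (rule sum.cong) (auto simp: c'_def)
    also have "smult (c' k) (w k) = - (\<Sum>i\<in>I - {k}. smult (c i * coeff (w i) d) (w k))"
      by (simp add: c'_def smult_sum)
    also have "\<dots> + (\<Sum>i\<in>I - {k}. smult (c i * a) (w i)) = (\<Sum>i\<in>I - {k}. smult (c i) (w' i))"
      by (simp add: w'_def smult_diff_right sum_subtractf)
    finally have "(\<Sum>i\<in>I. smult (c' i) (w i)) = 0" using c(2) by simp
    moreover have "\<exists>i\<in>I. c' i \<noteq> 0" using c(1) k by (auto simp: c'_def a_def)
    ultimately show ?thesis by blast
  qed
qed

lemma pcompose_monom_eq: "pcompose (monom c i) w = smult c (w ^ i)"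
  for w :: "'b::comm_ring_1 poly"
  by (induction i) (simp_all add: monom_0 monom_Suc pcompose_pCons mult_smult_right)

text \<open>The powers of \<open>w\<close> up to exponent \<open>degree f\<close>, scaled and
  reduced modulo \<open>f\<close> by pseudo-division, are \<open>degree f + 1\<close> vectors with
  \<open>degree f\<close> coordinates. A linear dependence among them gives the coefficients of
  \<open>M\<close>.\<close>

lemma ex_annihilating_polynomial_mod:
  fixes f w :: "'b::idom poly"
  assumes "f \<noteq> 0"
  shows "\<exists>M. M \<noteq> 0 \<and> f dvd pcompose M w"
proof -
  define a where "a = lead_coeff f"
  have "\<forall>i. \<exists>K q r. smult (a ^ K) (w ^ i) = f * q + r \<and> (r = 0 \<or> degree r < degree f)"
    using pseudo_division[OF assms] unfolding a_def by blast
  then obtain K q r where *: "\<And>i. smult (a ^ K i) (w ^ i) = f * q i + r i"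
      "\<And>i::nat. r i = 0 \<or> degree (r i) < degree f" by metis
  have "coeff (r i) j = 0" if "j \<ge> degree f" for i j
    using *(2)[of i] that by (auto intro: coeff_eq_0)
  then obtain c where c: "\<exists>i\<in>{..degree f}. c i \<noteq> 0" "(\<Sum>i\<le>degree f. smult (c i) (r i)) = 0"
    using linear_dependence[of "{..degree f}" "degree f" r] by auto
  define M where "M = (\<Sum>i\<le>degree f. monom (c i * a ^ K i) i)"
  have coeff: "coeff M i = c i * a ^ K i" if "i \<le> degree f" for i
    using that by (simp add: M_def coeff_sum sum.delta)
  obtain i where "i \<le> degree f" "c i \<noteq> 0" using c(1) by auto
  then have "coeff M i \<noteq> 0" using assms by (simp add: coeff a_def)
  then have "M \<noteq> 0" by auto
  have "pcompose M w = (\<Sum>i\<le>degree f. smult (c i) (smult (a ^ K i) (w ^ i)))"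
    by (simp add: M_def pcompose_sum pcompose_monom_eq)
  also have "\<dots> = f * (\<Sum>i\<le>degree f. smult (c i) (q i)) + (\<Sum>i\<le>degree f. smult (c i) (r i))"
    by (simp add: *(1) smult_add_right sum.distrib sum_distrib_left)
  finally have "f dvd pcompose M w" using c(2) by simp
  with \<open>M \<noteq> 0\<close> show ?thesis by blast
qed

section \<open>Construction of eliminating polynomials\<close>

lemma diff_dvd_poly_diff: "x - y dvd poly M x - poly M y" for x y :: "'b::comm_ring_1"
proof (induction M)
  case (pCons a M)
  have "poly (pCons a M) x - poly (pCons a M) y = x * (poly M x - poly M y) + (x - y) * poly M y"
    by (simp add: algebra_simps)
  then show ?case using pCons.IH by (simp add: dvd_add)
qed simp

text \<open>\<open>S\<close> plays the role of the resultant in \<open>x\<close> of \<open>f\<close> and \<open>f\<^sub>t + \<beta> f\<^sub>x\<close>, a polynomial in \<open>\<beta>\<close>.\<close>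

definition eliminates :: "'a::field poly poly \<Rightarrow> 'a poly poly \<Rightarrow> bool" where
  "eliminates S f \<longleftrightarrow> S \<noteq> 0 \<and> (\<forall>P b \<beta>. prime_elem P \<longrightarrow> P dvd poly f b \<longrightarrow>
     P dvd poly (total_deriv \<beta> f) b \<longrightarrow> P dvd poly S \<beta>)"

text \<open>If \<open>P\<close> divides \<open>f1(b)\<close>, the product rule shows that it divides
  \<open>f2(b)\<close> times the derivative of \<open>f1\<close>. Either it divides that derivative,
  and \<open>S1\<close> takes over, or it divides both \<open>f1(b)\<close> and
  \<open>f2(b)\<close>, hence \<open>c\<close>. The other case is symmetric.\<close>

lemma eliminates_mult:
  assumes "eliminates S1 f1" and "eliminates S2 f2"
    and "u * f1 + v * f2 = [:c:]" and "c \<noteq> 0"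
  shows "eliminates (smult c (S1 * S2)) (f1 * f2)"
  unfolding eliminates_def
proof (intro conjI allI impI)
  show "smult c (S1 * S2) \<noteq> 0" using assms by (simp add: eliminates_def)
next
  fix P b \<beta>
  assume P: "prime_elem P" and 1: "P dvd poly (f1 * f2) b"
    and 2: "P dvd poly (total_deriv \<beta> (f1 * f2)) b"
  let ?D1 = "poly (total_deriv \<beta> f1) b" and ?D2 = "poly (total_deriv \<beta> f2) b"
  have D: "P dvd poly f1 b * ?D2 + poly f2 b * ?D1" using 2 by (simp add: total_deriv_mult)
  have c: "poly u b * poly f1 b + poly v b * poly f2 b = c"
    using arg_cong[OF assms(3), of "\<lambda>p. poly p b"] by simp
  have *: "P dvd c" if "P dvd poly f1 b" "P dvd poly f2 b"
    using that c by (metis dvd_add dvd_mult)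
  consider "P dvd poly f1 b" | "P dvd poly f2 b"
    using 1 P prime_elem_dvd_multD by auto
  then have "P dvd c \<or> P dvd poly S1 \<beta> \<or> P dvd poly S2 \<beta>"
  proof cases
    case 1
    then have "P dvd poly f2 b * ?D1" using D by (simp add: dvd_add_right_iff)
    then show ?thesis using * 1 P prime_elem_dvd_multD assms(1) unfolding eliminates_def by blast
  next
    case 2
    then have "P dvd poly f1 b * ?D2" using D by (simp add: dvd_add_left_iff)
    then show ?thesis using * 2 P prime_elem_dvd_multD assms(2) unfolding eliminates_def by blast
  qed
  then show "P dvd poly (smult c (S1 * S2)) \<beta>" by auto
qed

lemma degree_pderiv_less: "degree f \<noteq> 0 \<Longrightarrow> degree (pderiv f) < degree f"
  for f :: "'b::{comm_semiring_1,semiring_no_zero_divisors} poly"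
proof -
  assume "degree f \<noteq> 0"
  moreover have "degree (pderiv f) \<le> degree f - 1"
    by (rule degree_le) (auto simp: coeff_pderiv coeff_eq_0)
  ultimately show ?thesis by simp
qed

lemma is_unit_poly_poly_obtain:
  fixes d :: "'a::field poly poly"
  assumes "d dvd 1"
  obtains c where "d = [:c:]" "c \<noteq> 0"
  using assms that by (metis is_unit_polyE dvd_0_left_iff zero_neq_one pCons_0_0 not_is_unit_0)

text \<open>The common divisor must be a unit: otherwise it would be associated to \<open>f\<close>,
  and \<open>f\<close> would divide \<open>h\<close>.\<close>

lemma irreducible_bezout:
  fixes f h :: "'a::field poly poly"
  assumes "irreducible f" and "\<not> f dvd h"
  shows "\<exists>c u v. c \<noteq> 0 \<and> u * f + v * h = [:c:]"
proof -
  have "f \<noteq> 0" using assms(1) by auto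
  then obtain c d u v where cd: "c \<noteq> 0" "u * f + v * h = smult c d" "d dvd f" "d dvd h"
    using bezout_up_to_constant[OF \<open>f \<noteq> 0\<close>, of h] by blast
  obtain e where e: "f = d * e" using cd(3) by auto
  have "d dvd 1"
  proof (rule ccontr)
    assume "\<not> d dvd 1"
    then have "e dvd 1" using assms(1) e irreducibleD by blast
    then have "f dvd d" using e by (simp add: mult_unit_dvd_iff)
    then show False using assms(2) cd(4) dvd_trans by blast
  qed
  then obtain d0 where "d = [:d0:]" "d0 \<noteq> 0" by (rule is_unit_poly_poly_obtain)
  then show ?thesis using cd by (intro exI[of _ "c * d0"] exI[of _ u] exI[of _ v]) simp
qed

text \<open>\<open>tderiv\<close> does not raise the degree in \<open>x\<close>, so the quotient
  would be some nonzero \<open>c\<close> in \<open>t\<close> alone. Then \<open>lead_coeff f\<close>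
  would divide its own derivative with nonzero quotient \<open>c\<close>, although that derivative
  is zero or of smaller degree.\<close>

lemma not_dvd_tderiv:
  assumes "f \<noteq> 0" and "tderiv f \<noteq> 0"
  shows "\<not> f dvd tderiv f"
proof
  assume "f dvd tderiv f"
  then obtain e where e: "tderiv f = f * e" by auto
  then have "e \<noteq> 0" using assms by auto
  then have "degree e = 0" using degree_tderiv_le[of f] assms(1) by (simp add: e degree_mult_eq)
  then obtain c where c: "e = [:c:]" by (auto elim: degree_eq_zeroE)
  then have c0: "c \<noteq> 0" using \<open>e \<noteq> 0\<close> by auto
  have "pderiv (lead_coeff f) = lead_coeff f * c"
    using arg_cong[OF e, of "\<lambda>p. coeff p (degree f)"] by (simp add: coeff_tderiv c mult.commute)
  then have "lead_coeff f dvd pderiv (lead_coeff f)" "pderiv (lead_coeff f) \<noteq> 0"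
    using c0 assms(1) by simp_all
  then have "degree (lead_coeff f) \<le> degree (pderiv (lead_coeff f))" by (rule dvd_imp_degree_le)
  then have "degree (lead_coeff f) = 0" using degree_pderiv_less by (metis not_le)
  then have "pderiv (lead_coeff f) = 0" by (auto elim!: degree_eq_zeroE)
  with \<open>pderiv (lead_coeff f) \<noteq> 0\<close> show False by simp
qed

text \<open>If \<open>f\<close> is free of \<open>x\<close>, then \<open>f(b)\<close> does not
  depend on \<open>b\<close> and \<open>S = f\<close> works. If \<open>pderiv f = 0\<close>, then
  \<open>tderiv f\<close> is nonzero, since an irreducible \<open>f\<close> is no
  \<open>p\<close>-th power, and a Bezout identity for \<open>f\<close> and \<open>tderiv f\<close>
  gives a constant \<open>S\<close>. Otherwise such an identity for \<open>f\<close> and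
  \<open>pderiv f\<close> determines \<beta> modulo \<open>P\<close> up to the factor
  \<open>c\<close>.\<close>

lemma ex_eliminates_irreducible:
  fixes f :: "'a::finite_field poly poly"
  assumes "irreducible f"
  shows "\<exists>S. eliminates S f"
proof -
  have f0: "f \<noteq> 0" using assms by auto
  show ?thesis
  proof (cases "degree f = 0")
    case True
    then obtain c where "f = [:c:]" by (auto elim: degree_eq_zeroE)
    then show ?thesis using f0 by (intro exI[of _ f]) (simp add: eliminates_def)
  next
    case deg: False
    show ?thesis
    proof (cases "pderiv f = 0")
      case True
      have "tderiv f \<noteq> 0"
      proof
        assume "tderiv f = 0"
        then obtain h where h: "f = h ^ CHAR('a)" using True power_CHAR_if_derivs_eq_0 by blast
        have p: "CHAR('a) > 1" using prime_gt_1_nat CHAR_prime by blast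
        then have "f = h * h ^ (CHAR('a) - 1)" using h by (simp flip: power_Suc)
        then have "h dvd 1 \<or> h ^ (CHAR('a) - 1) dvd 1" using assms irreducibleD by blast
        then have "h dvd 1" using p by (auto simp: is_unit_power_iff)
        then have "f dvd 1" by (simp add: h is_unit_power_iff)
        then show False using assms by (simp add: irreducible_def)
      qed
      then obtain c u v where c: "c \<noteq> 0" "u * f + v * tderiv f = [:c:]"
        using irreducible_bezout[OF assms not_dvd_tderiv] f0 by blast
      have "P dvd c" if P: "P dvd poly f b" "P dvd poly (tderiv f) b" for P b
      proof -
        have "poly u b * poly f b + poly v b * poly (tderiv f) b = c"
          using arg_cong[OF c(2), of "\<lambda>p. poly p b"] by simp
        then show ?thesis using P by (metis dvd_add dvd_mult)
      qed
      then have "eliminates [:c:] f"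
        using c(1) True by (auto simp: eliminates_def total_deriv_def)
      then show ?thesis by blast
    next
      case False
      have "\<not> f dvd pderiv f"
        using degree_pderiv_less[OF deg] dvd_imp_degree_le[of f "pderiv f"] False by auto
      then obtain c u v where c: "c \<noteq> 0" "u * f + v * pderiv f = [:c:]"
        using irreducible_bezout[OF assms] by blast
      \<comment> \<open>From \<open>u f + v f\<^sub>x = c\<close>, modulo \<open>P\<close> the second hypothesis becomes \<open>v f\<^sub>t = - c \<beta>\<close>, and a
        polynomial annihilating \<open>v f\<^sub>t\<close> modulo \<open>f\<close> gives a relation for \<open>\<beta>\<close> alone.\<close>
      obtain M where M: "M \<noteq> 0" "f dvd pcompose M (v * tderiv f)"
        using ex_annihilating_polynomial_mod[OF f0] by blast
      define S where "S = pcompose M [:0, - c:]"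
      have "S \<noteq> 0" using M(1) c(1) unfolding S_def by (auto dest: pcompose_eq_0)
      moreover have "P dvd poly S \<beta>" if P: "P dvd poly f b" "P dvd poly (total_deriv \<beta> f) b" for P b \<beta>
      proof -
        let ?F = "poly f b" and ?T = "poly (tderiv f) b" and ?X = "poly (pderiv f) b"
        let ?u = "poly u b" and ?v = "poly v b"
        have eq: "?u * ?F + ?v * ?X = c" using arg_cong[OF c(2), of "\<lambda>p. poly p b"] by simp
        have "?v * ?T - (- c * \<beta>) = ?v * poly (total_deriv \<beta> f) b + ?u * \<beta> * ?F"
          by (simp add: total_deriv_def algebra_simps flip: eq)
        then have "P dvd ?v * ?T - (- c * \<beta>)" using P by simp
        then have "P dvd poly M (?v * ?T) - poly M (- c * \<beta>)"
          using diff_dvd_poly_diff dvd_trans by blast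
        moreover have "P dvd poly M (?v * ?T)"
        proof -
          obtain w where "pcompose M (v * tderiv f) = f * w" using M(2) by auto
          then have "poly M (?v * ?T) = ?F * poly w b"
            by (metis poly_mult poly_pcompose)
          then show ?thesis using P(1) by simp
        qed
        ultimately have "P dvd poly M (- c * \<beta>)" by (simp add: dvd_diff_right_iff)
        then show ?thesis by (simp add: S_def poly_pcompose mult.commute)
      qed
      ultimately show ?thesis unfolding eliminates_def by blast
    qed
  qed
qed

lemma ex_eliminates_squarefree:
  fixes f :: "'a::finite_field poly poly"
  assumes "squarefree f"
  shows "\<exists>S. eliminates S f"
  using assms
\<comment> \<open>The measure is additive on products and vanishes only on units.\<close>
proof (induction "degree f + degree (lead_coeff f)" arbitrary: f rule: less_induct)
  case less
  have f0: "f \<noteq> 0" using less.prems by auto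
  consider "f dvd 1" | "irreducible f" | f1 f2 where "f = f1 * f2" "\<not> f1 dvd 1" "\<not> f2 dvd 1"
    using f0 by (auto simp: irreducible_def)
  then show ?case
  proof cases
    case 1
    then obtain c where "f = [:c:]" "c \<noteq> 0" by (rule is_unit_poly_poly_obtain)
    then show ?thesis by (intro exI[of _ f]) (simp add: eliminates_def)
  next
    case 2
    then show ?thesis by (rule ex_eliminates_irreducible)
  next
    case (3 f1 f2)
    have nz: "f1 \<noteq> 0" "f2 \<noteq> 0" using f0 3 by auto
    have pos: "degree e + degree (lead_coeff e) > 0" if "e \<noteq> 0" "\<not> e dvd 1" for e :: "'a poly poly"
    proof (rule ccontr)
      assume "\<not> ?thesis"
      then have "degree e = 0" "degree (lead_coeff e) = 0" by auto
      then obtain c where c: "e = [:c:]" by (auto elim: degree_eq_zeroE)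
      then have "degree c = 0" "c \<noteq> 0" using \<open>degree (lead_coeff e) = 0\<close> that by auto
      then have "c dvd 1" by (simp add: is_unit_iff_degree)
      then show False using that c by (simp add: is_unit_const_poly_iff)
    qed
    have sum: "degree f + degree (lead_coeff f) =
      (degree f1 + degree (lead_coeff f1)) + (degree f2 + degree (lead_coeff f2))"
      using nz by (simp only: 3(1) lead_coeff_mult) (simp add: degree_mult_eq)
    have sq: "squarefree f1" "squarefree f2"
      using less.prems 3(1) by (auto dest: squarefree_multD)
    obtain S1 S2 where S: "eliminates S1 f1" "eliminates S2 f2"
      using less.hyps[of f1] less.hyps[of f2] sq sum pos[OF nz(1) 3(2)] pos[OF nz(2) 3(3)] by auto
    obtain c d u v where cd: "c \<noteq> 0" "u * f1 + v * f2 = smult c d" "d dvd f1" "d dvd f2"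
      using bezout_up_to_constant[OF nz(1)] by blast
    \<comment> \<open>A common divisor of both factors enters \<open>f\<close> squared, so
      square-freeness makes it a unit and supplies the constant required by
      \<open>eliminates_mult\<close>.\<close>
    have "d\<^sup>2 dvd f" using cd by (simp add: 3(1) power2_eq_square mult_dvd_mono)
    then have "d dvd 1" using less.prems by (rule squarefreeD[rotated])
    then obtain d0 where "d = [:d0:]" "d0 \<noteq> 0" by (rule is_unit_poly_poly_obtain)
    then have "u * f1 + v * f2 = [:c * d0:]" "c * d0 \<noteq> 0" using cd by auto
    from eliminates_mult[OF S this] show ?thesis by (auto simp: 3(1))
  qed
qed

subsection \<open>Counting in residue classes\<close>

text \<open>Serves both as the set of remainders modulo a polynomial of degree \<open>d\<close> and
  as the shape of a short interval. The disjunct for \<open>0\<close> makes the count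
  \<open>q ^ d\<close> right for \<open>d = 0\<close> too, as \<open>degree 0 = 0\<close>.\<close>

definition deg_less :: "nat \<Rightarrow> 'a::zero poly set" where
  "deg_less d = {a. a = 0 \<or> degree a < d}"

lemma deg_less_0: "deg_less 0 = {0}"
  by (auto simp: deg_less_def)

lemma deg_less_Suc: "deg_less (Suc d) = (\<lambda>(c, a). pCons c a) ` (UNIV \<times> deg_less d)"
proof -
  have "x \<in> (\<lambda>(c, a). pCons c a) ` (UNIV \<times> deg_less d)" if "x \<in> deg_less (Suc d)" for x :: "'a poly"
  proof -
    obtain c a where x: "x = pCons c a" by (rule pCons_cases)
    then have "a \<in> deg_less d" using that by (auto simp: deg_less_def split: if_splits)
    then show ?thesis using x by auto
  qed
  moreover have "pCons c a \<in> deg_less (Suc d)" if "a \<in> deg_less d" for c and a :: "'a poly"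
    using that by (auto simp: deg_less_def)
  ultimately show ?thesis by auto
qed

lemma finite_deg_less: "finite (deg_less d :: 'a::{zero,finite} poly set)"
  by (induction d) (simp_all add: deg_less_0 deg_less_Suc)

lemma card_deg_less: "card (deg_less d :: 'a::{zero,finite} poly set) = CARD('a) ^ d"
proof (induction d)
  case (Suc d)
  have "inj_on (\<lambda>(c, a). pCons c a) (UNIV \<times> deg_less d :: ('a \<times> 'a poly) set)"
    by (auto simp: inj_on_def)
  then show ?case by (simp add: deg_less_Suc card_image card_cartesian_product Suc)
qed (simp add: deg_less_0)

lemma deg_less_add: "a \<in> deg_less d \<Longrightarrow> b \<in> deg_less d \<Longrightarrow> a + b \<in> deg_less d"
  for a b :: "'b::comm_monoid_add poly"
  unfolding deg_less_def using degree_add_le_max[of a b] by (fastforce simp: max_def split: if_splits)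

lemma deg_less_diff: "a \<in> deg_less d \<Longrightarrow> b \<in> deg_less d \<Longrightarrow> a - b \<in> deg_less d"
  for a b :: "'b::ab_group_add poly"
  using deg_less_add[of a d "- b"] by (auto simp: deg_less_def)

lemma deg_less_mono: "d \<le> d' \<Longrightarrow> deg_less d \<subseteq> deg_less d'"
  by (auto simp: deg_less_def)

lemma deg_less_mult_iff:
  fixes D c :: "'b::idom poly"
  assumes "D \<noteq> 0" and "degree D \<le> m"
  shows "D * c \<in> deg_less m \<longleftrightarrow> c \<in> deg_less (m - degree D)"
  using assms by (cases "c = 0") (auto simp: deg_less_def degree_mult_eq)

lemma mod_in_deg_less: "D \<noteq> 0 \<Longrightarrow> a mod D \<in> deg_less (degree D)"
  for D :: "'a::field poly"
  using degree_mod_less[of D a] by (auto simp: deg_less_def)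

lemma deg_less_mod: "a \<in> deg_less (degree D) \<Longrightarrow> a mod D = a"
  for D :: "'a::field poly"
  by (auto simp: deg_less_def mod_poly_less)

lemma eq_if_dvd_diff_deg_less:
  fixes D :: "'a::field poly"
  assumes "a \<in> deg_less (degree D)" and "b \<in> deg_less (degree D)" and "D dvd a - b"
  shows "a = b"
  using assms by (metis deg_less_mod mod_eq_dvd_iff)

lemma short_interval_eq: "short_interval N m = (+) N ` deg_less m"
  by (auto simp: short_interval_def deg_less_def)

lemma in_short_interval_iff: "b \<in> short_interval N m \<longleftrightarrow> b - N \<in> deg_less m"
  by (auto simp: short_interval_eq image_iff) (metis add_diff_cancel_left' diff_add_cancel add.commute)

lemma finite_short_interval: "finite (short_interval N m)"
  by (simp add: short_interval_eq finite_deg_less)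

lemma card_short_interval: "card (short_interval (N :: 'a::finite_field poly) m) = CARD('a) ^ m"
  by (simp add: short_interval_eq card_image card_deg_less)

text \<open>Since \<open>degree D \<le> m\<close>, the interval splits into
  \<open>q ^ (m - degree D)\<close> complete residue systems modulo \<open>D\<close>.\<close>

lemma card_short_interval_periodic:
  fixes N D :: "'a::finite_field poly"
  assumes "D \<noteq> 0" and "degree D \<le> m" and per: "\<And>a b. D dvd a - b \<Longrightarrow> Q a \<longleftrightarrow> Q b"
  shows "card {b \<in> short_interval N m. Q b} =
    CARD('a) ^ (m - degree D) * card {r \<in> deg_less (degree D). Q r}"
proof -
  define A where "A = {r \<in> deg_less (degree D). Q r}"
  \<comment> \<open>The residue is taken relative to \<open>N\<close>: then \<open>h (r, c)\<close>
    is congruent to \<open>r\<close> modulo \<open>D\<close>, and its offset from \<open>N\<close>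
    has quotient \<open>c\<close> on division by \<open>D\<close>.\<close>
  define h where "h = (\<lambda>(r, c). N + ((r - N) mod D + D * c))"
  have "bij_betw h (A \<times> deg_less (m - degree D)) {b \<in> short_interval N m. Q b}"
    unfolding bij_betw_def
  proof
    have "r = r' \<and> c = c'" if r: "r \<in> A" "r' \<in> A" and eq: "h (r, c) = h (r', c')" for r r' c c'
    proof -
      have eq': "(r - N) mod D + D * c = (r' - N) mod D + D * c'" using eq by (simp add: h_def)
      have 1: "(r - N) mod D = (r' - N) mod D"
        using arg_cong[OF eq', of "\<lambda>x. x mod D"] by (simp add: mod_mult_self2)
      then have "D dvd r - r'" by (simp add: mod_eq_dvd_iff)
      then have "r = r'" using r eq_if_dvd_diff_deg_less by (auto simp: A_def)
      then show ?thesis using eq' assms(1) by simp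
    qed
    then show "inj_on h (A \<times> deg_less (m - degree D))" by (auto intro!: inj_onI)
    show "h ` (A \<times> deg_less (m - degree D)) = {b \<in> short_interval N m. Q b}"
    proof (intro equalityI subsetI)
      fix b assume "b \<in> h ` (A \<times> deg_less (m - degree D))"
      then obtain r c where rc: "b = h (r, c)" "r \<in> A" "c \<in> deg_less (m - degree D)" by auto
      have "(r - N) mod D \<in> deg_less m"
        using mod_in_deg_less[OF assms(1)] deg_less_mono[OF assms(2)] by blast
      moreover have "D * c \<in> deg_less m" using rc(3) deg_less_mult_iff assms by blast
      ultimately have "b \<in> short_interval N m"
        by (simp add: in_short_interval_iff rc(1) h_def deg_less_add)
      moreover have "b - r = D * c - ((r - N) - (r - N) mod D)" by (simp add: rc(1) h_def)
      then have "D dvd b - r" by (simp add: minus_mod_eq_mult_div dvd_diff)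
      then have "Q b" using per rc(2) by (auto simp: A_def)
      ultimately show "b \<in> {b \<in> short_interval N m. Q b}" by simp
    next
      fix b assume b: "b \<in> {b \<in> short_interval N m. Q b}"
      define r where "r = b mod D"
      define c where "c = (b - N) div D"
      have "D dvd r - b" unfolding r_def using mod_eq_dvd_iff by fastforce
      then have "r \<in> A"
        using b per mod_in_deg_less[OF assms(1)] unfolding A_def r_def by blast
      have rN: "(r - N) mod D = (b - N) mod D" by (simp add: r_def mod_diff_left_eq)
      have eq: "(b - N) mod D + D * c = b - N" by (simp add: c_def)
      have "D * c = (b - N) - (b - N) mod D" by (simp add: c_def minus_mod_eq_mult_div)
      moreover have "(b - N) mod D \<in> deg_less m"
        using mod_in_deg_less[OF assms(1)] deg_less_mono[OF assms(2)] by blast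
      moreover have "b - N \<in> deg_less m" using b by (simp add: in_short_interval_iff)
      ultimately have "D * c \<in> deg_less m" by (simp add: deg_less_diff)
      then have "c \<in> deg_less (m - degree D)" using deg_less_mult_iff assms by blast
      moreover have "b = h (r, c)" by (simp only: h_def prod.case rN eq) simp
      ultimately show "b \<in> h ` (A \<times> deg_less (m - degree D))" using \<open>r \<in> A\<close> by blast
    qed
  qed
  from bij_betw_same_card[OF this] show ?thesis
    by (simp add: A_def card_cartesian_product card_deg_less mult.commute)
qed

text \<open>Coprimality, stated as a divisibility property, makes the pair of remainders injective.
  Surjectivity follows by counting, as both sides have \<open>q ^ (degree A + degree B)\<close>
  elements.\<close>

lemma card_chinese_remainder:
  fixes A B :: "'a::finite_field poly"
  assumes "A \<noteq> 0" "B \<noteq> 0" and coprime: "\<And>x. A dvd x \<Longrightarrow> B dvd x \<Longrightarrow> A * B dvd x"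
    and perA: "\<And>a b. A dvd a - b \<Longrightarrow> QA a \<longleftrightarrow> QA b"
    and perB: "\<And>a b. B dvd a - b \<Longrightarrow> QB a \<longleftrightarrow> QB b"
  shows "card {r \<in> deg_less (degree (A * B)). QA r \<and> QB r} =
    card {r \<in> deg_less (degree A). QA r} * card {r \<in> deg_less (degree B). QB r}"
proof -
  define h where "h r = (r mod A, r mod B)" for r
  have inj: "inj_on h (deg_less (degree (A * B)))"
  proof (rule inj_onI)
    fix r r' assume r: "r \<in> deg_less (degree (A * B))" "r' \<in> deg_less (degree (A * B))" "h r = h r'"
    then have "A * B dvd r - r'" by (intro coprime) (simp_all add: h_def mod_eq_dvd_iff)
    then show "r = r'" using r eq_if_dvd_diff_deg_less by blast
  qed
  have sub: "h ` deg_less (degree (A * B)) \<subseteq> deg_less (degree A) \<times> deg_less (degree B)"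
    using assms(1,2) by (auto simp: h_def mod_in_deg_less)
  have "card (h ` deg_less (degree (A * B))) = CARD('a) ^ degree (A * B)"
    by (simp only: card_image[OF inj] card_deg_less)
  then have surj: "h ` deg_less (degree (A * B)) = deg_less (degree A) \<times> deg_less (degree B)"
    by (intro card_subset_eq[OF _ sub])
       (simp_all add: finite_deg_less card_cartesian_product card_deg_less degree_mult_eq
         assms(1,2) power_add)
  have QA: "QA (r mod A) \<longleftrightarrow> QA r" and QB: "QB (r mod B) \<longleftrightarrow> QB r" for r
    by (auto intro!: perA perB simp flip: mod_eq_dvd_iff)
  have "h ` {r \<in> deg_less (degree (A * B)). QA r \<and> QB r} =
    {r \<in> deg_less (degree A). QA r} \<times> {r \<in> deg_less (degree B). QB r}" (is "?L = ?R")
  proof (intro equalityI subsetI)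
    fix x assume "x \<in> ?L"
    then show "x \<in> ?R" using sub QA QB by (auto simp: h_def)
  next
    fix x assume x: "x \<in> ?R"
    then have "x \<in> h ` deg_less (degree (A * B))" using surj by auto
    then show "x \<in> ?L" using x QA QB by (auto simp: h_def)
  qed
  moreover have "inj_on h {r \<in> deg_less (degree (A * B)). QA r \<and> QB r}"
    by (rule inj_on_subset[OF inj]) auto
  ultimately show ?thesis
    using card_image[of h "{r \<in> deg_less (degree (A * B)). QA r \<and> QB r}"]
    by (simp only: card_cartesian_product)
qed

section \<open>Sieving by squares of finitely many monic irreducibles\<close>

lemma monic_irreducibles_prime_elem: "P \<in> monic_irreducibles \<Longrightarrow> prime_elem P"
  by (simp add: monic_irreducibles_def field_poly_irreducible_imp_prime)

lemma monic_irreducibles_nonzero: "P \<in> monic_irreducibles \<Longrightarrow> P \<noteq> 0"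
  by (auto simp: monic_irreducibles_def)

lemma monic_irreducibles_dvd_eq:
  assumes "P \<in> monic_irreducibles" "Q \<in> monic_irreducibles" "P dvd Q"
  shows "P = Q"
proof -
  obtain c where c: "Q = P * c" using assms(3) by auto
  have "\<not> P dvd 1" using assms(1) by (auto simp: monic_irreducibles_def irreducible_def)
  then have "c dvd 1" using assms(2) c by (auto simp: monic_irreducibles_def irreducible_def)
  then obtain c0 where c0: "c = [:c0:]" by (auto simp: is_unit_poly_iff)
  have "lead_coeff Q = lead_coeff P * lead_coeff c" by (simp add: c lead_coeff_mult)
  then have "c0 = 1" using assms(1,2) by (simp add: monic_irreducibles_def c0)
  then show ?thesis by (simp add: c c0 flip: one_pCons)
qed

lemma prime_elem_not_dvd_prod:
  assumes "prime_elem P" and "finite F" and "\<And>Q. Q \<in> F \<Longrightarrow> \<not> P dvd f Q"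
  shows "\<not> P dvd prod f F"
  using assms(2,3)
proof (induction F rule: finite_induct)
  case empty
  then show ?case using assms(1) by (auto simp: prime_elem_def)
next
  case (insert x F)
  have "\<not> P dvd f x * prod f F"
    using insert prime_elem_dvd_multD[OF assms(1)] by blast
  then show ?case using insert.hyps by simp
qed

text \<open>The coprimality needed for the Chinese remainder theorem: each of the two factors
  \<open>P\<close> must divide the cofactor of \<open>B\<close>.\<close>

lemma prime_elem_square_mult_dvd:
  assumes "prime_elem (P :: 'b::idom)" "\<not> P dvd B" "P\<^sup>2 dvd x" "B dvd x"
  shows "P\<^sup>2 * B dvd x"
proof -
  have P0: "P \<noteq> 0" using assms(1) by (auto simp: prime_elem_def)
  obtain y where y: "x = B * y" using assms(4) by auto
  have "P dvd B * y" using assms(3) y by (auto simp: power2_eq_square elim!: dvd_mult_left)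
  then have "P dvd y" using assms prime_elem_dvd_multD by blast
  then obtain z where z: "y = P * z" by auto
  have "P * P dvd P * (B * z)" using assms(3) by (simp add: y z power2_eq_square ac_simps)
  then have "P dvd B * z" using P0 by simp
  then have "P dvd z" using assms prime_elem_dvd_multD by blast
  then show ?thesis by (auto simp: y z power2_eq_square ac_simps)
qed

lemma card_square_sieve_prod:
  fixes g :: "'a::finite_field poly poly"
  assumes "finite F" and "F \<subseteq> monic_irreducibles"
  shows "card {r \<in> deg_less (degree (\<Prod>P\<in>F. P\<^sup>2)). \<forall>P\<in>F. \<not> P\<^sup>2 dvd poly g r} =
    (\<Prod>P\<in>F. card {r \<in> deg_less (degree (P\<^sup>2)). \<not> P\<^sup>2 dvd poly g r})"
  using assms
proof (induction F rule: finite_induct)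
  case empty
  then show ?case by (simp add: deg_less_0)
next
  case (insert P F)
  have P: "prime_elem P" "P \<noteq> 0"
    using insert.prems monic_irreducibles_prime_elem monic_irreducibles_nonzero by auto
  have per: "(P\<^sup>2 dvd poly g a) \<longleftrightarrow> (P\<^sup>2 dvd poly g b)" if "P\<^sup>2 dvd a - b" for P a b :: "'a poly"
  proof -
    have "P\<^sup>2 dvd poly g a - poly g b" using that diff_dvd_poly_diff dvd_trans by blast
    then show ?thesis by (metis diff_eq_eq dvd_add_right_iff)
  qed
  let ?B = "\<Prod>P\<in>F. P\<^sup>2"
  have nd: "\<not> P dvd ?B"
  proof (rule prime_elem_not_dvd_prod[OF P(1) insert.hyps(1)])
    fix Q assume "Q \<in> F"
    then have "\<not> P dvd Q" using insert monic_irreducibles_dvd_eq by blast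
    then show "\<not> P dvd Q\<^sup>2" using P(1) prime_elem_dvd_power by blast
  qed
  have B0: "?B \<noteq> 0" using insert monic_irreducibles_nonzero by auto
  have perB: "(\<forall>P\<in>F. \<not> P\<^sup>2 dvd poly g a) \<longleftrightarrow> (\<forall>P\<in>F. \<not> P\<^sup>2 dvd poly g b)"
    if "?B dvd a - b" for a b
  proof -
    have "P\<^sup>2 dvd a - b" if "P \<in> F" for P
      using dvd_prodI[OF insert.hyps(1) that, of "\<lambda>P. P\<^sup>2"] \<open>?B dvd a - b\<close> dvd_trans by blast
    then show ?thesis using per by blast
  qed
  have "card {r \<in> deg_less (degree (P\<^sup>2 * ?B)). \<not> P\<^sup>2 dvd poly g r \<and> (\<forall>P\<in>F. \<not> P\<^sup>2 dvd poly g r)} =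
    card {r \<in> deg_less (degree (P\<^sup>2)). \<not> P\<^sup>2 dvd poly g r} *
    card {r \<in> deg_less (degree ?B). \<forall>P\<in>F. \<not> P\<^sup>2 dvd poly g r}"
    using P B0 per perB prime_elem_square_mult_dvd[OF P(1) nd]
    by (intro card_chinese_remainder) auto
  then show ?case using insert by simp
qed

lemma rho_eq:
  assumes "D \<noteq> 0"
  shows "rho g D = card {r \<in> deg_less (degree D). D dvd poly g r}"
proof -
  have *: "D dvd poly g (a mod D) \<longleftrightarrow> D dvd poly g a" for a
  proof -
    have "D dvd poly g (a mod D) - poly g a"
      by (rule dvd_trans[OF _ diff_dvd_poly_diff]) (metis mod_eq_dvd_iff mod_mod_trivial)
    then show ?thesis by (metis diff_eq_eq dvd_add_right_iff)
  qed
  have "{a mod D | a. [poly g a = 0] (mod D)} = {r \<in> deg_less (degree D). D dvd poly g r}"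
    using * mod_in_deg_less[OF assms] by (auto simp: cong_0_iff) (metis deg_less_mod)
  then show ?thesis by (simp add: rho_def)
qed

lemma poly_norm_power2: "poly_norm (P :: 'a::finite_field poly) ^ 2 = CARD('a) ^ degree (P\<^sup>2)"
proof (cases "P = 0")
  case False
  then show ?thesis by (simp add: poly_norm_def degree_power_eq mult.commute flip: power_mult)
qed (simp add: poly_norm_def)

lemma card_square_sieve:
  fixes g :: "'a::finite_field poly poly"
  assumes "P \<noteq> 0"
  shows "real (card {r \<in> deg_less (degree (P\<^sup>2)). \<not> P\<^sup>2 dvd poly g r}) =
    real (CARD('a)) ^ degree (P\<^sup>2) * (1 - real (rho g (P\<^sup>2)) / real (poly_norm P) ^ 2)"
proof -
  let ?V = "deg_less (degree (P\<^sup>2)) :: 'a poly set"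
  have "{r \<in> ?V. \<not> P\<^sup>2 dvd poly g r} = ?V - {r \<in> ?V. P\<^sup>2 dvd poly g r}" by auto
  also have "real (card \<dots>) = real (card ?V) - real (card {r \<in> ?V. P\<^sup>2 dvd poly g r})"
    by (subst card_Diff_subset) (auto simp: finite_deg_less of_nat_diff card_mono)
  also have "\<dots> = real (CARD('a)) ^ degree (P\<^sup>2) - real (rho g (P\<^sup>2))"
    using assms by (simp add: card_deg_less rho_eq)
  also have "real (poly_norm P) ^ 2 = real (CARD('a)) ^ degree (P\<^sup>2)"
    using poly_norm_power2[of P] by (metis of_nat_power)
  ultimately show ?thesis by (simp add: right_diff_distrib)
qed

text \<open>Exact rather than asymptotic, because the degree of the sieve modulus is at most
  \<open>m\<close>.\<close>

lemma card_short_interval_sieve: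
  fixes g :: "'a::finite_field poly poly"
  assumes "finite F" and "F \<subseteq> monic_irreducibles" and "degree (\<Prod>P\<in>F. P\<^sup>2) \<le> m"
  shows "real (card {b \<in> short_interval N m. \<forall>P\<in>F. \<not> P\<^sup>2 dvd poly g b}) =
    real (CARD('a)) ^ m * (\<Prod>P\<in>F. 1 - real (rho g (P\<^sup>2)) / real (poly_norm P) ^ 2)"
proof -
  let ?D = "\<Prod>P\<in>F. P\<^sup>2"
  have D0: "?D \<noteq> 0" using assms monic_irreducibles_nonzero by auto
  have deg: "degree ?D = (\<Sum>P\<in>F. degree (P\<^sup>2))"
    using assms monic_irreducibles_nonzero by (intro degree_prod_eq_sum_degree) auto
  have per: "(\<forall>P\<in>F. \<not> P\<^sup>2 dvd poly g a) \<longleftrightarrow> (\<forall>P\<in>F. \<not> P\<^sup>2 dvd poly g b)"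
    if "?D dvd a - b" for a b
  proof -
    have "P\<^sup>2 dvd poly g a - poly g b" if "P \<in> F" for P
    proof -
      have "P\<^sup>2 dvd ?D" using dvd_prodI[OF assms(1) that] .
      also note \<open>?D dvd a - b\<close>
      also have "a - b dvd poly g a - poly g b" by (rule diff_dvd_poly_diff)
      finally show ?thesis .
    qed
    then show ?thesis by (metis diff_eq_eq dvd_add_right_iff)
  qed
  have "card {b \<in> short_interval N m. \<forall>P\<in>F. \<not> P\<^sup>2 dvd poly g b} = CARD('a) ^ (m - degree ?D) *
     card {r \<in> deg_less (degree ?D). \<forall>P\<in>F. \<not> P\<^sup>2 dvd poly g r}"
    by (rule card_short_interval_periodic[OF D0 assms(3) per])
  also have "real \<dots> = real (CARD('a)) ^ (m - degree ?D) *
    (\<Prod>P\<in>F. real (CARD('a)) ^ degree (P\<^sup>2) * (1 - real (rho g (P\<^sup>2)) / real (poly_norm P) ^ 2))"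
    unfolding card_square_sieve_prod[OF assms(1,2)] of_nat_mult of_nat_prod of_nat_power
    using assms(2) monic_irreducibles_nonzero
    by (intro arg_cong2[where f = "(*)"] refl prod.cong card_square_sieve) auto
  also have "\<dots> = real (CARD('a)) ^ (m - degree ?D + degree ?D) *
    (\<Prod>P\<in>F. 1 - real (rho g (P\<^sup>2)) / real (poly_norm P) ^ 2)"
    by (simp add: prod.distrib power_add deg power_sum)
  finally show ?thesis using assms(3) by simp
qed

subsection \<open>Roots modulo squares of primes\<close>

text \<open>Lagrange's bound for the roots of \<open>g\<close> modulo \<open>P\<close>, without
  forming the quotient ring: split off \<open>x - c\<close> for a root \<open>c\<close> and use that
  \<open>P\<close> is prime. The condition on \<open>[:P:]\<close> says that \<open>g\<close> is
  nonzero modulo \<open>P\<close>.\<close>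

lemma card_roots_mod_prime_le:
  fixes g :: "'b::idom poly"
  assumes "prime_elem P" and "finite A" and "\<not> [:P:] dvd g"
    and "\<And>a. a \<in> A \<Longrightarrow> P dvd poly g a"
    and "\<And>a b. a \<in> A \<Longrightarrow> b \<in> A \<Longrightarrow> P dvd a - b \<Longrightarrow> a = b"
  shows "card A \<le> degree g"
  using assms(2-)
proof (induction "degree g" arbitrary: g A)
  case 0
  then obtain c where c: "g = [:c:]" by (metis degree_eq_zeroE)
  then have "A = {}" using "0.prems"(2,3) by auto
  then show ?case by simp
next
  case (Suc n)
  show ?case
  proof (cases "A = {}")
    case False
    then obtain c where c: "c \<in> A" by blast
    define h where "h = synthetic_div g c"
    have g: "g = [:-c, 1:] * h + [:poly g c:]" by (simp only: h_def synthetic_div_correct')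
    have "[:P:] dvd [:poly g c:]" using Suc.prems(3)[OF c] by simp
    then have h: "\<not> [:P:] dvd h" using Suc.prems(2) g by (metis dvd_add dvd_mult)
    have "P dvd poly h a" if a: "a \<in> A - {c}" for a
    proof -
      have "poly g a = (a - c) * poly h a + poly g c" by (subst g) (simp add: algebra_simps)
      then have "P dvd (a - c) * poly h a"
        using Suc.prems(3)[of a] Suc.prems(3)[OF c] a by (simp add: dvd_add_left_iff)
      moreover have "\<not> P dvd a - c" using Suc.prems(4)[of a c] a c by auto
      ultimately show ?thesis using assms(1) prime_elem_dvd_multD by blast
    qed
    moreover have "n = degree h" using Suc.hyps(2) by (simp add: h_def degree_synthetic_div)
    ultimately have "card (A - {c}) \<le> n"
      using Suc.hyps(1)[of h "A - {c}"] Suc.prems(1,4) h by blast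
    then show ?thesis using Suc.hyps(2) Suc.prems(1) c by simp
  qed simp
qed

lemma not_const_dvd_if_degree_gt:
  fixes g :: "'a::field poly poly"
  assumes "g \<noteq> 0" and "degree P > degree (lead_coeff g)"
  shows "\<not> [:P:] dvd g"
proof
  assume "[:P:] dvd g"
  then have "P dvd lead_coeff g" by (simp only: const_poly_dvd_iff)
  then show False using assms dvd_imp_degree_le[of P "lead_coeff g"] by simp
qed

lemma square_dvd_poly_taylor:
  "h\<^sup>2 dvd poly g (a + h) - poly g a - h * poly (pderiv g) a" for h :: "'b::idom"
proof (induction g)
  case (pCons c g)
  have "poly (pCons c g) (a + h) - poly (pCons c g) a - h * poly (pderiv (pCons c g)) a =
    (a + h) * (poly g (a + h) - poly g a - h * poly (pderiv g) a) + h\<^sup>2 * poly (pderiv g) a"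
    by (simp add: pderiv_pCons algebra_simps power2_eq_square)
  then show ?case using pCons.IH by (metis dvd_add dvd_mult dvd_triv_left)
qed simp

text \<open>The uniqueness half of Hensel's lemma: the Taylor expansion at \<open>a\<close> makes
  \<open>P\<^sup>2\<close> divide the linear term, and \<open>P\<close> does not divide the
  derivative at \<open>a\<close>.\<close>

lemma simple_root_lift_unique:
  fixes P :: "'b::idom"
  assumes "prime_elem P" and "P\<^sup>2 dvd poly g a" and "P\<^sup>2 dvd poly g b"
    and "\<not> P dvd poly (pderiv g) a" and "P dvd b - a"
  shows "P\<^sup>2 dvd b - a"
proof -
  obtain c where c: "b - a = P * c" using assms(5) by auto
  have "P\<^sup>2 dvd (b - a)\<^sup>2" using assms(5) by (rule dvd_power_same)
  then have "P\<^sup>2 dvd poly g b - poly g a - (b - a) * poly (pderiv g) a"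
    using square_dvd_poly_taylor[of "b - a" g a] dvd_trans by fastforce
  then have "P\<^sup>2 dvd (b - a) * poly (pderiv g) a"
    using assms(2,3) by (metis dvd_diff dvd_diff_right_iff)
  then have "P * P dvd P * (c * poly (pderiv g) a)" by (simp add: c power2_eq_square mult.assoc)
  then have "P dvd c * poly (pderiv g) a" using assms(1) by (simp add: prime_elem_def)
  then have "P dvd c" using assms(1,4) prime_elem_dvd_multD by blast
  then show ?thesis by (simp add: c power2_eq_square mult_dvd_mono)
qed

lemma infinite_UNIV_poly: "infinite (UNIV :: 'a::field poly set)"
proof
  assume "finite (UNIV :: 'a poly set)"
  then have "finite (range (\<lambda>n. monom (1::'a) n))" by (rule finite_subset[rotated]) simp
  moreover have "inj (\<lambda>n. monom (1::'a) n)" by (auto simp: inj_def monom_eq_iff')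
  ultimately show False using finite_imageD infinite_UNIV_nat by blast
qed

text \<open>Fix one \<beta> with \<open>S(\<beta>)\<close> nonzero. If \<open>P\<^sup>2\<close>
  divides \<open>g(r)\<close> and \<open>P\<close> divides \<open>pderiv g\<close> at
  \<open>r\<close>, then \<open>P\<close> divides \<open>tderiv g\<close> at \<open>r\<close> as
  well, hence also \<open>S(\<beta>)\<close>. So for large \<open>P\<close> all roots modulo
  \<open>P\<^sup>2\<close> are simple and are determined by their classes modulo
  \<open>P\<close>.\<close>

lemma rho_square_le_degree:
  fixes g :: "'a::finite_field poly poly"
  assumes "squarefree g"
  shows "\<exists>d1. \<forall>P\<in>monic_irreducibles. degree P \<ge> d1 \<longrightarrow> rho g (P\<^sup>2) \<le> degree g"
proof -
  have g0: "g \<noteq> 0" using assms by auto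
  obtain S where S: "eliminates S g" using ex_eliminates_squarefree[OF assms] by blast
  then have "finite {\<beta>. poly S \<beta> = 0}" by (simp add: eliminates_def poly_roots_finite)
  then obtain \<beta> where \<beta>: "poly S \<beta> \<noteq> 0"
    using infinite_UNIV_poly by (metis (mono_tags) UNIV_eq_I mem_Collect_eq)
  \<comment> \<open>The threshold exceeds the degree of \<open>poly S \<beta>\<close>, so that
    \<open>P\<close> cannot divide it, and the degree of \<open>lead_coeff g\<close>, so that
    \<open>g\<close> is nonzero modulo \<open>P\<close>.\<close>
  have "rho g (P\<^sup>2) \<le> degree g"
    if P: "P \<in> monic_irreducibles"
      and deg: "degree P \<ge> Suc (degree (poly S \<beta>) + degree (lead_coeff g))" for P
  proof -
    have pr: "prime_elem P" "P \<noteq> 0"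
      using P monic_irreducibles_prime_elem monic_irreducibles_nonzero by auto
    define A where "A = {r \<in> deg_less (degree (P\<^sup>2)). P\<^sup>2 dvd poly g r}"
    have P2: "P dvd poly g r" if "r \<in> A" for r
      using that dvd_trans[of P "P\<^sup>2"] by (simp add: A_def)
    have simple: "\<not> P dvd poly (pderiv g) r" if r: "r \<in> A" for r
    proof
      assume *: "P dvd poly (pderiv g) r"
      have "P dvd pderiv (poly g r)" using r by (auto simp: A_def intro: square_dvd_imp_dvd_pderiv)
      then have "P dvd poly (tderiv g) r"
        using * by (simp add: pderiv_poly total_deriv_def dvd_add_left_iff)
      then have "P dvd poly (total_deriv \<beta> g) r" using * by (simp add: total_deriv_def)
      then have "P dvd poly S \<beta>" using S pr(1) P2[OF r] by (simp add: eliminates_def)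
      then show False using \<beta> dvd_imp_degree_le[of P "poly S \<beta>"] deg by simp
    qed
    have "card A \<le> degree g"
    proof (rule card_roots_mod_prime_le[OF pr(1)])
      show "finite A" by (simp add: A_def finite_deg_less)
      show "\<not> [:P:] dvd g" using not_const_dvd_if_degree_gt[OF g0] deg by simp
      show "P dvd poly g a" if "a \<in> A" for a using that by (rule P2)
      show "a = b" if "a \<in> A" "b \<in> A" "P dvd a - b" for a b
      proof -
        have "P\<^sup>2 dvd a - b"
          using that simple[of b] simple_root_lift_unique[OF pr(1), of g b a] by (auto simp: A_def)
        then show ?thesis using that eq_if_dvd_diff_deg_less by (auto simp: A_def)
      qed
    qed
    then show ?thesis using pr(2) by (simp add: rho_eq A_def)
  qed
  then show ?thesis by blast
qed

lemma finite_monic_irreducibles_degree_le: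
  "finite {P \<in> monic_irreducibles :: 'a::finite_field poly set. degree P \<le> d}"
  by (rule finite_subset[OF _ finite_deg_less[of "Suc d"]]) (auto simp: deg_less_def)

lemma card_monic_irreducibles_degree_le:
  "card {P \<in> monic_irreducibles :: 'a::finite_field poly set. degree P = d} \<le> CARD('a) ^ d"
proof -
  let ?A = "{P \<in> monic_irreducibles :: 'a poly set. degree P = d}"
  have "(\<lambda>P. P - monom 1 d) ` ?A \<subseteq> deg_less d"
  proof
    fix x :: "'a poly" assume "x \<in> (\<lambda>P. P - monom 1 d) ` ?A"
    then obtain P where P: "x = P - monom 1 d" "P \<in> monic_irreducibles" "degree P = d" by auto
    have c: "coeff x i = 0" if "i \<ge> d" for i
      using that P by (cases "i = d") (auto simp: monic_irreducibles_def coeff_eq_0)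
    show "x \<in> deg_less d"
    proof (cases "x = 0")
      case False
      then have "coeff x (degree x) \<noteq> 0" by simp
      then have "\<not> d \<le> degree x" using c by blast
      then show ?thesis by (simp add: deg_less_def)
    qed (simp add: deg_less_def)
  qed
  then have "card ((\<lambda>P. P - monom 1 d) ` ?A) \<le> CARD('a) ^ d"
    using card_mono[OF finite_deg_less] by (metis card_deg_less)
  then show ?thesis by (simp add: card_image inj_on_def)
qed

lemma CARD_field_ge_2: "CARD('a::finite_field) \<ge> 2"
proof -
  have "card {0, 1 :: 'a} \<le> CARD('a)" by (rule card_mono) auto
  then show ?thesis by simp
qed

text \<open>There are at most \<open>q ^ i\<close> monic irreducibles of degree \<open>i\<close>,
  each contributing \<open>1 / q ^ (2 * i)\<close>; what remains is a geometric tail.\<close>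

lemma sum_inverse_square_norm_le:
  fixes F :: "'a::finite_field poly set"
  assumes "finite F" and "F \<subseteq> monic_irreducibles" and "\<And>P. P \<in> F \<Longrightarrow> degree P > d"
  shows "(\<Sum>P\<in>F. 1 / real (poly_norm P) ^ 2) \<le> 1 / real (CARD('a)) ^ d"
proof -
  let ?q = "real (CARD('a))"
  have q2: "?q \<ge> 2" using CARD_field_ge_2[where 'a='a] by linarith
  obtain n where n: "n \<ge> d" "\<And>P. P \<in> F \<Longrightarrow> degree P \<le> n"
  proof
    show "d \<le> Max (insert d (degree ` F))" using assms(1) by simp
    show "degree P \<le> Max (insert d (degree ` F))" if "P \<in> F" for P using assms(1) that by simp
  qed
  \<comment> \<open>The subtracted \<open>1 / q ^ n\<close> makes the induction close, since
    \<open>2 / q ^ (n + 1) \<le> 1 / q ^ n\<close> for \<open>q \<ge> 2\<close>.\<close>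
  have geo: "(\<Sum>i\<in>{d<..n}. 1 / ?q ^ i) \<le> 1 / ?q ^ d - 1 / ?q ^ n"
    using n(1)
  proof (induction n rule: dec_induct)
    case (step n)
    have "{d<..Suc n} = insert (Suc n) {d<..n}" using step by auto
    moreover have "2 * (1 / ?q ^ Suc n) \<le> 1 / ?q ^ n" using q2 by (simp add: field_simps)
    ultimately show ?case using step.IH by simp
  qed simp
  have "(\<Sum>P\<in>F. 1 / real (poly_norm P) ^ 2) =
    (\<Sum>i\<in>{d<..n}. \<Sum>P | P \<in> F \<and> degree P = i. 1 / real (poly_norm P) ^ 2)"
    using assms(1,3) n(2) by (intro sum.group[symmetric]) auto
  also have "\<dots> \<le> (\<Sum>i\<in>{d<..n}. 1 / ?q ^ i)"
  proof (rule sum_mono)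
    fix i
    have "card {P. P \<in> F \<and> degree P = i} \<le>
        card {P \<in> monic_irreducibles :: 'a poly set. degree P = i}"
      using assms(2) finite_monic_irreducibles_degree_le[of i]
      by (intro card_mono) (auto elim!: finite_subset[rotated])
    then have le: "card {P. P \<in> F \<and> degree P = i} \<le> CARD('a) ^ i"
      using card_monic_irreducibles_degree_le le_trans by blast
    have "(\<Sum>P | P \<in> F \<and> degree P = i. 1 / real (poly_norm P) ^ 2) =
       real (card {P. P \<in> F \<and> degree P = i}) * (1 / (?q ^ i) ^ 2)"
      by (simp add: poly_norm_def)
    also have "\<dots> \<le> ?q ^ i * (1 / (?q ^ i) ^ 2)"
      using le by (intro mult_right_mono) (simp_all flip: of_nat_power)
    also have "\<dots> = 1 / ?q ^ i" using q2 by (simp add: power2_eq_square)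
    finally show "(\<Sum>P | P \<in> F \<and> degree P = i. 1 / real (poly_norm P) ^ 2) \<le> 1 / ?q ^ i" .
  qed
  also note geo
  finally show ?thesis using q2 by (smt (verit) divide_nonneg_nonneg zero_le_power)
qed

subsection \<open>Large primes\<close>

lemma sum_degree_prime_divisors_le:
  fixes s :: "'a::finite_field poly"
  assumes "finite F" and "F \<subseteq> monic_irreducibles" and "s \<noteq> 0" and "\<And>P. P \<in> F \<Longrightarrow> P dvd s"
  shows "(\<Sum>P\<in>F. degree P) \<le> degree s"
proof -
  have "\<Prod>F dvd s"
    using assms(1,2,4)
  proof (induction F rule: finite_induct)
    case (insert P F)
    have P: "prime_elem P" using insert.prems monic_irreducibles_prime_elem by auto
    have "\<not> P dvd \<Prod>F"
      using insert monic_irreducibles_dvd_eq by (intro prime_elem_not_dvd_prod[OF P]) blast+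
    moreover obtain y where y: "s = \<Prod>F * y" using insert by auto
    ultimately have "P dvd y" using insert.prems(2)[of P] prime_elem_dvd_multD[OF P] by auto
    then show ?case using insert.hyps by (auto simp: y mult.commute[of P] mult_dvd_mono)
  qed simp
  then have "degree (\<Prod>F) \<le> degree s" using assms(3) by (rule dvd_imp_degree_le)
  moreover have "degree (\<Prod>F) = (\<Sum>P\<in>F. degree P)"
    using assms(2) monic_irreducibles_nonzero by (intro degree_prod_eq_sum_degree) auto
  ultimately show ?thesis by simp
qed

text \<open>Distinct prime divisors have total degree at most \<open>degree s\<close>, and each of
  these has degree above \<open>m / 2\<close>.\<close>

lemma card_large_prime_divisors_le:
  fixes s :: "'a::finite_field poly" and m :: nat
  assumes "s \<noteq> 0"
  defines "Ps \<equiv> {P \<in> monic_irreducibles. m < 2 * degree P \<and> P dvd s}"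
  shows "finite Ps" and "card Ps * m \<le> 2 * degree s"
proof -
  show fin: "finite Ps"
    using assms dvd_imp_degree_le[of _ s]
    by (auto intro: finite_subset[OF _ finite_monic_irreducibles_degree_le[of "degree s"]])
  have "card Ps * m = (\<Sum>P\<in>Ps. m)" by simp
  also have "\<dots> \<le> (\<Sum>P\<in>Ps. 2 * degree P)" by (rule sum_mono) (auto simp: Ps_def)
  also have "\<dots> \<le> 2 * degree s"
    unfolding sum_distrib_left[symmetric] using assms fin
    by (intro mult_left_mono sum_degree_prime_divisors_le) (auto simp: Ps_def)
  finally show "card Ps * m \<le> 2 * degree s" .
qed

section \<open>Translation by \<open>p\<close>-th powers\<close>

text \<open>The degree bound is the ceiling of \<open>m / p\<close>, so that for
  \<open>m > 0\<close> these are the \<open>y\<close> whose \<open>p\<close>-th power has degree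
  below \<open>m\<close>.\<close>

definition frobenius_roots :: "nat \<Rightarrow> 'a::finite_field poly set" where
  "frobenius_roots m = deg_less ((m + CHAR('a) - 1) div CHAR('a))"

lemma frobenius_roots_iff:
  fixes y :: "'a::finite_field poly"
  assumes "m > 0"
  shows "y \<in> frobenius_roots m \<longleftrightarrow> y ^ CHAR('a) \<in> deg_less m"
proof (cases "y = 0")
  case False
  have p: "CHAR('a) > 0" by simp
  have "degree y < (m + CHAR('a) - 1) div CHAR('a) \<longleftrightarrow> Suc (degree y) * CHAR('a) \<le> m + CHAR('a) - 1"
    using p by (simp add: less_eq_div_iff_mult_less_eq Suc_le_eq[symmetric])
  also have "\<dots> \<longleftrightarrow> CHAR('a) * degree y < m"
    using p assms by (simp add: mult.commute) linarith
  finally show ?thesis using False by (simp add: frobenius_roots_def deg_less_def degree_power_eq)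
qed (simp_all add: frobenius_roots_def deg_less_def)

lemma power_CHAR_diff: "(x - y) ^ CHAR('a) = x ^ CHAR('a) - y ^ CHAR('a)"
  for x y :: "'a::finite_field poly"
proof -
  have "((x - y) + y) ^ CHAR('a) = (x - y) ^ CHAR('a) + y ^ CHAR('a)"
    by (rule freshmans_dream) simp_all
  then show ?thesis by simp
qed

lemma pderiv_power_CHAR: "pderiv (y ^ CHAR('a)) = 0" for y :: "'a::finite_field poly"
  by (simp add: pderiv_power)

text \<open>Two elements of a fibre differ by a \<open>p\<close>-th power of degree below
  \<open>m\<close>. This controls the exceptional \<open>b\<close> whose derivative is a root of
  \<open>S\<close>.\<close>

lemma card_pderiv_fibre_le:
  fixes N :: "'a::finite_field poly"
  assumes "m > 0"
  shows "card {b \<in> short_interval N m. pderiv b = \<beta>} \<le> card (frobenius_roots m :: 'a poly set)"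
proof (cases "{b \<in> short_interval N m. pderiv b = \<beta>} = {}")
  case False
  then obtain b0 where b0: "b0 \<in> short_interval N m" "pderiv b0 = \<beta>" by blast
  have "{b \<in> short_interval N m. pderiv b = \<beta>} \<subseteq> (\<lambda>y. b0 + y ^ CHAR('a)) ` frobenius_roots m"
  proof
    fix b assume b: "b \<in> {b \<in> short_interval N m. pderiv b = \<beta>}"
    have "pderiv (b - b0) = 0" using b b0 by (simp add: pderiv_diff)
    then obtain y where y: "b - b0 = y ^ CHAR('a)"
      using power_CHAR_if_pderiv_eq_0_finite_field by blast
    have "(b - N) - (b0 - N) \<in> deg_less m"
      using deg_less_diff[of "b - N" m "b0 - N"] b b0
      by (simp only: in_short_interval_iff mem_Collect_eq)
    then have "y \<in> frobenius_roots m" using y assms by (simp add: frobenius_roots_iff)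
    moreover have "b = b0 + y ^ CHAR('a)" using y by (simp add: algebra_simps)
    ultimately show "b \<in> (\<lambda>y. b0 + y ^ CHAR('a)) ` frobenius_roots m" by blast
  qed
  then show ?thesis
    by (rule surj_card_le[rotated]) (simp add: finite_deg_less frobenius_roots_def)
qed (simp only: card.empty zero_le)

text \<open>As \<open>m < 2 * degree P\<close> and \<open>p \<ge> 2\<close>, the ceiling of
  \<open>m / p\<close> is at most \<open>degree P\<close>, so distinct \<open>y\<close> are
  incongruent modulo \<open>P\<close>. The Frobenius is injective modulo \<open>P\<close>, hence so
  are the translates, and the root bound modulo \<open>P\<close> applies.\<close>

lemma card_frobenius_translates_le:
  fixes g :: "'a::finite_field poly poly"
  assumes "prime_elem P" and "\<not> [:P:] dvd g" and "m < 2 * degree P"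
  shows "card {y \<in> frobenius_roots m. P dvd poly g (b + y ^ CHAR('a))} \<le> degree g"
proof -
  let ?Y = "{y \<in> frobenius_roots m. P dvd poly g (b + y ^ CHAR('a))}"
  have "(m + CHAR('a) - 1) div CHAR('a) \<le> degree P"
  proof -
    have p: "CHAR('a) \<ge> 2" using prime_ge_2_nat CHAR_prime by blast
    have "2 * degree P \<le> CHAR('a) * degree P" using p by (rule mult_le_mono1)
    then have "m + CHAR('a) - 1 < CHAR('a) * degree P + CHAR('a)" using assms(3) p by linarith
    then have "m + CHAR('a) - 1 < Suc (degree P) * CHAR('a)" by (simp add: ac_simps)
    then show ?thesis using p by (metis div_less_iff_less_mult less_Suc_eq_le less_le_trans zero_less_numeral)
  qed
  then have sub: "(frobenius_roots m :: 'a poly set) \<subseteq> deg_less (degree P)"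
    unfolding frobenius_roots_def by (rule deg_less_mono)
  have eq: "y = z" if "y \<in> ?Y" "z \<in> ?Y" "P dvd (b + y ^ CHAR('a)) - (b + z ^ CHAR('a))" for y z
  proof -
    have "P dvd (y - z) ^ CHAR('a)" using that(3) by (simp add: power_CHAR_diff)
    then have "P dvd y - z" using assms(1) prime_elem_dvd_power by blast
    then show ?thesis using that sub eq_if_dvd_diff_deg_less[of y P z] by auto
  qed
  have "finite ?Y" by (simp add: frobenius_roots_def finite_deg_less)
  have "card ((\<lambda>y. b + y ^ CHAR('a)) ` ?Y) \<le> degree g"
  proof (rule card_roots_mod_prime_le[OF assms(1) _ assms(2)])
    fix x z assume xz: "x \<in> (\<lambda>y. b + y ^ CHAR('a)) ` ?Y" "z \<in> (\<lambda>y. b + y ^ CHAR('a)) ` ?Y" "P dvd x - z"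
    then obtain y y' where "x = b + y ^ CHAR('a)" "y \<in> ?Y" "z = b + y' ^ CHAR('a)" "y' \<in> ?Y"
      by blast
    then show "x = z" using eq[of y y'] xz(3) by simp
  qed (use \<open>finite ?Y\<close> in auto)
  moreover have "inj_on (\<lambda>y. b + y ^ CHAR('a)) ?Y"
  proof (rule inj_onI)
    fix y z assume "y \<in> ?Y" "z \<in> ?Y" and "b + y ^ CHAR('a) = b + z ^ CHAR('a)"
    then show "y = z" using eq[of y z] by simp
  qed
  ultimately show ?thesis by (simp add: card_image)
qed

lemma ex_degree_poly_bound: "\<exists>C. \<forall>\<beta>. degree (poly S \<beta>) \<le> C * (degree \<beta> + 1)"
  for S :: "'b::idom poly poly"
proof (induction S)
  case (pCons a S)
  then obtain C where C: "\<And>\<beta>. degree (poly S \<beta>) \<le> C * (degree \<beta> + 1)" by blast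
  have "degree (poly (pCons a S) \<beta>) \<le> (degree a + C + 1) * (degree \<beta> + 1)" for \<beta>
  proof -
    have "degree (poly (pCons a S) \<beta>) \<le> max (degree a) (degree (\<beta> * poly S \<beta>))"
      by (simp add: degree_add_le_max)
    also have "\<dots> \<le> degree a + (degree \<beta> + C * (degree \<beta> + 1))"
      using degree_mult_le[of \<beta> "poly S \<beta>"] C[of \<beta>] by simp
    also have "\<dots> \<le> (degree a + C + 1) * (degree \<beta> + 1)" by (simp add: algebra_simps)
    finally show ?thesis .
  qed
  then show ?case by blast
qed simp

lemma short_interval_add: "b \<in> short_interval N m \<Longrightarrow> h \<in> deg_less m \<Longrightarrow> b + h \<in> short_interval N m"
  using deg_less_add[of "b - N" m h] by (simp only: in_short_interval_iff diff_add_eq)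

lemma short_interval_diff: "b \<in> short_interval N m \<Longrightarrow> h \<in> deg_less m \<Longrightarrow> b - h \<in> short_interval N m"
  using deg_less_diff[of "b - N" m h] by (simp add: in_short_interval_iff diff_diff_eq add.commute)

lemma degree_short_interval_le: "b \<in> short_interval N m \<Longrightarrow> degree b \<le> max (degree N) m"
  using degree_add_le_max[of N "b - N"] by (auto simp: in_short_interval_iff deg_less_def)

text \<open>The cut at \<open>m / 2\<close> is where \<open>P\<^sup>2\<close> outgrows the interval
  and divisibility by it can no longer be counted exactly by periodicity.\<close>

definition large_square_divisor :: "'a::finite_field poly poly \<Rightarrow> nat \<Rightarrow> 'a poly \<Rightarrow> bool" where
  "large_square_divisor g m b \<longleftrightarrow> (\<exists>P\<in>monic_irreducibles. m < 2 * degree P \<and> P\<^sup>2 dvd poly g b)"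

text \<open>Double counting of the pairs \<open>(b, y)\<close> with \<open>b + y ^ p\<close> bad,
  multiplied by \<open>m\<close> to stay within the naturals. The first summand comes from the
  \<open>b\<close> with \<open>S(b')\<close> nonzero. The second comes from the others: they lie in
  at most \<open>degree S\<close> fibres of the derivative, of size at most \<open>Y\<close>, and
  each gets the trivial bound of \<open>Y\<close> translates.\<close>

lemma card_large_square_divisor_le:
  fixes g S :: "'a::finite_field poly poly"
  assumes "eliminates S g" and "2 * degree (lead_coeff g) \<le> m" and "m > 0"
    and C: "\<And>\<beta>. degree (poly S \<beta>) \<le> C * (degree \<beta> + 1)" and "g \<noteq> 0"
  defines "Y \<equiv> card (frobenius_roots m :: 'a poly set)"
  shows "Y * m * card {b \<in> short_interval N m. large_square_divisor g m b} \<le>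
    CARD('a) ^ m * (2 * degree g * C * (max (degree N) m + 1)) + m * degree S * Y ^ 2"
proof -
  let ?I = "short_interval N m" and ?bad = "large_square_divisor g m"
  let ?Y = "frobenius_roots m :: 'a poly set" and ?p = "CHAR('a)"
  let ?L = "C * (max (degree N) m + 1)"
  have finY: "finite ?Y" by (simp add: frobenius_roots_def finite_deg_less)
  have finI: "finite ?I" by (rule finite_short_interval)
  have S0: "S \<noteq> 0" using assms(1) by (simp add: eliminates_def)
  have shift: "card {b \<in> ?I. ?bad (b + y ^ ?p)} = card {b \<in> ?I. ?bad b}" if "y \<in> ?Y" for y
  proof -
    have y: "y ^ ?p \<in> deg_less m" using that assms(3) by (simp add: frobenius_roots_iff)
    have "bij_betw (\<lambda>b. b + y ^ ?p) {b \<in> ?I. ?bad (b + y ^ ?p)} {b \<in> ?I. ?bad b}"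
    proof (rule bij_betwI[where g = "\<lambda>b. b - y ^ ?p"])
      show "(\<lambda>b. b + y ^ ?p) \<in> {b \<in> ?I. ?bad (b + y ^ ?p)} \<rightarrow> {b \<in> ?I. ?bad b}"
        using short_interval_add[OF _ y] by auto
      show "(\<lambda>b. b - y ^ ?p) \<in> {b \<in> ?I. ?bad b} \<rightarrow> {b \<in> ?I. ?bad (b + y ^ ?p)}"
        using short_interval_diff[OF _ y] by auto
    qed auto
    then show ?thesis by (rule bij_betw_same_card)
  qed
  have bound: "m * card {y \<in> ?Y. ?bad (b + y ^ ?p)} \<le> 2 * degree g * ?L"
    if b: "b \<in> ?I" and nz: "poly S (pderiv b) \<noteq> 0" for b
  proof -
    let ?s = "poly S (pderiv b)"
    define Ps where "Ps = {P \<in> monic_irreducibles. m < 2 * degree P \<and> P dvd ?s}"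
    have finPs: "finite Ps" and Ps: "card Ps * m \<le> 2 * degree ?s"
      unfolding Ps_def by (rule card_large_prime_divisors_le[OF nz])+
    have "{y \<in> ?Y. ?bad (b + y ^ ?p)} \<subseteq> (\<Union>P\<in>Ps. {y \<in> ?Y. P dvd poly g (b + y ^ ?p)})"
    proof
      fix y assume "y \<in> {y \<in> ?Y. ?bad (b + y ^ ?p)}"
      then obtain P where y: "y \<in> ?Y" and P: "P \<in> monic_irreducibles" "m < 2 * degree P"
        "P\<^sup>2 dvd poly g (b + y ^ ?p)" by (auto simp: large_square_divisor_def)
      have 1: "P dvd poly g (b + y ^ ?p)" using P(3) by (metis dvd_trans dvd_triv_left power2_eq_square)
      have "P dvd pderiv (poly g (b + y ^ ?p))" using P(3) by (rule square_dvd_imp_dvd_pderiv)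
      then have "P dvd poly (total_deriv (pderiv b) g) (b + y ^ ?p)"
        by (simp add: pderiv_poly pderiv_add pderiv_power_CHAR)
      then have "P dvd ?s"
        using 1 assms(1) monic_irreducibles_prime_elem[OF P(1)] by (simp add: eliminates_def)
      then show "y \<in> (\<Union>P\<in>Ps. {y \<in> ?Y. P dvd poly g (b + y ^ ?p)})"
        using y 1 P by (auto simp: Ps_def)
    qed
    then have "card {y \<in> ?Y. ?bad (b + y ^ ?p)} \<le> card (\<Union>P\<in>Ps. {y \<in> ?Y. P dvd poly g (b + y ^ ?p)})"
      using finPs finY by (intro card_mono) auto
    also have "\<dots> \<le> (\<Sum>P\<in>Ps. card {y \<in> ?Y. P dvd poly g (b + y ^ ?p)})"
      by (rule card_UN_le[OF finPs])
    also have "\<dots> \<le> (\<Sum>P\<in>Ps. degree g)"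
    proof (rule sum_mono)
      fix P assume P: "P \<in> Ps"
      then have "\<not> [:P:] dvd g"
        using assms(2) by (intro not_const_dvd_if_degree_gt[OF \<open>g \<noteq> 0\<close>]) (auto simp: Ps_def)
      then show "card {y \<in> ?Y. P dvd poly g (b + y ^ ?p)} \<le> degree g"
        using P monic_irreducibles_prime_elem
        by (intro card_frobenius_translates_le) (auto simp: Ps_def)
    qed
    finally have "m * card {y \<in> ?Y. ?bad (b + y ^ ?p)} \<le> degree g * (card Ps * m)"
      by (simp add: mult.commute mult.left_commute mult_le_mono2)
    also have "\<dots> \<le> degree g * (2 * degree ?s)" using Ps by (rule mult_le_mono2)
    also have "degree ?s \<le> C * (degree (pderiv b) + 1)" by (rule C)
    also have "\<dots> \<le> ?L"
    proof -
      have "degree (pderiv b) \<le> degree b" using degree_pderiv_less[of b]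
        by (cases "degree b = 0") (auto elim!: degree_eq_zeroE)
      then show ?thesis using degree_short_interval_le[OF b] by (intro mult_le_mono2) simp
    qed
    finally show ?thesis by (simp add: ac_simps)
  qed
  let ?Z = "{b \<in> ?I. poly S (pderiv b) = 0}"
  have cardZ: "card ?Z \<le> degree S * Y"
  proof -
    have "?Z = (\<Union>\<beta>\<in>{\<beta>. poly S \<beta> = 0}. {b \<in> ?I. pderiv b = \<beta>})" by auto
    then have "card ?Z \<le> (\<Sum>\<beta> | poly S \<beta> = 0. card {b \<in> ?I. pderiv b = \<beta>})"
      using card_UN_le[OF poly_roots_finite[OF S0], of "\<lambda>\<beta>. {b \<in> ?I. pderiv b = \<beta>}"] by simp
    also have "\<dots> \<le> (\<Sum>\<beta> | poly S \<beta> = 0. Y)"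
      unfolding Y_def by (intro sum_mono card_pderiv_fibre_le assms(3))
    also have "\<dots> \<le> degree S * Y" using card_poly_roots_bound[OF S0] by simp
    finally show ?thesis .
  qed
  \<comment> \<open>Average over the translations by \<open>p\<close>-th powers, which preserve both the interval and \<open>b'\<close>.\<close>
  have "Y * m * card {b \<in> ?I. ?bad b} = m * (\<Sum>y\<in>?Y. card {b \<in> ?I. ?bad (b + y ^ ?p)})"
    using shift by (simp add: Y_def)
  also have "(\<Sum>y\<in>?Y. card {b \<in> ?I. ?bad (b + y ^ ?p)}) = (\<Sum>b\<in>?I. card {y \<in> ?Y. ?bad (b + y ^ ?p)})"
    by (intro sum_multicount_gen finY finI) simp
  also have "m * \<dots> = (\<Sum>b\<in>?I. m * card {y \<in> ?Y. ?bad (b + y ^ ?p)})"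
    by (rule sum_distrib_left)
  also have "\<dots> \<le> (\<Sum>b\<in>?I. 2 * degree g * ?L + (if b \<in> ?Z then m * Y else 0))"
  proof (rule sum_mono)
    fix b assume b: "b \<in> ?I"
    show "m * card {y \<in> ?Y. ?bad (b + y ^ ?p)} \<le> 2 * degree g * ?L + (if b \<in> ?Z then m * Y else 0)"
    proof (cases "b \<in> ?Z")
      case True
      have "card {y \<in> ?Y. ?bad (b + y ^ ?p)} \<le> Y"
        unfolding Y_def using finY by (intro card_mono) auto
      then show ?thesis using True by (simp add: trans_le_add2)
    next
      case False
      then show ?thesis using b bound[of b] by auto
    qed
  qed
  also have "\<dots> = CARD('a) ^ m * (2 * degree g * ?L) + m * Y * card ?Z"
    using finI by (simp add: sum.distrib card_short_interval sum.If_cases Int_def conj_commute)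
  also have "m * Y * card ?Z \<le> m * Y * (degree S * Y)" using cardZ by (rule mult_le_mono2)
  finally show ?thesis by (simp add: power2_eq_square algebra_simps)
qed

subsection \<open>The sieve\<close>

definition square_density :: "'a::finite_field poly poly \<Rightarrow> 'a poly \<Rightarrow> real" where
  "square_density g P = real (rho g (P\<^sup>2)) / real (poly_norm P) ^ 2"

definition partial_density :: "'a::finite_field poly poly \<Rightarrow> 'a poly set \<Rightarrow> real" where
  "partial_density g F = (\<Prod>P\<in>F. 1 - square_density g P)"

definition primes_upto :: "nat \<Rightarrow> 'a::finite_field poly set" where
  "primes_upto d = {P \<in> monic_irreducibles. degree P \<le> d}"

lemma finite_primes_upto: "finite (primes_upto d)"
  unfolding primes_upto_def by (rule finite_monic_irreducibles_degree_le)

lemma primes_upto_subset: "primes_upto d \<subseteq> monic_irreducibles"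
  by (auto simp: primes_upto_def)

lemma square_density_bounds:
  assumes "P \<in> monic_irreducibles"
  shows "square_density g P \<in> {0..1}"
proof -
  have P: "P \<noteq> 0" using assms by (rule monic_irreducibles_nonzero)
  have "rho g (P\<^sup>2) \<le> card (deg_less (degree (P\<^sup>2)) :: 'a poly set)"
    unfolding rho_eq[of "P\<^sup>2" g, simplified, OF P] by (rule card_mono) (auto simp: finite_deg_less)
  then have "rho g (P\<^sup>2) \<le> poly_norm P ^ 2" by (simp only: card_deg_less poly_norm_power2)
  then have "real (rho g (P\<^sup>2)) \<le> real (poly_norm P) ^ 2" by (metis of_nat_le_iff of_nat_power)
  then show ?thesis by (auto simp: square_density_def divide_le_eq_1)
qed

lemma partial_density_nonneg: "F \<subseteq> monic_irreducibles \<Longrightarrow> 0 \<le> partial_density g F"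
  unfolding partial_density_def using square_density_bounds by (intro prod_nonneg) fastforce

lemma partial_density_le_1: "F \<subseteq> monic_irreducibles \<Longrightarrow> partial_density g F \<le> 1"
  unfolding partial_density_def using square_density_bounds by (intro prod_le_1) fastforce

lemma partial_density_Un:
  assumes "finite F" and "finite G"
  shows "partial_density g (F \<union> G) = partial_density g F * partial_density g (G - F)"
  using prod.union_disjoint[of F "G - F"] assms by (simp add: partial_density_def)

lemma partial_density_antimono:
  assumes "finite G" and "F \<subseteq> G" and "G \<subseteq> monic_irreducibles"
  shows "partial_density g G \<le> partial_density g F"
proof -
  have "partial_density g G = partial_density g F * partial_density g (G - F)"
    using partial_density_Un[of F G g] assms finite_subset[of F G] by (simp add: Un_absorb1)
  then show ?thesis
    using assms partial_density_le_1[of "G - F" g] partial_density_nonneg[of F g]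
    by (auto intro: mult_left_le)
qed

text \<open>All factors lie in \<open>[0, 1]\<close>, so the partial products decrease along larger
  finite sets and converge to their infimum. Bounds for the constant thereby reduce to bounds for
  finite products.\<close>

lemma density_const_eq_Inf:
  "density_const g = Inf (partial_density g ` {F. finite F \<and> F \<subseteq> monic_irreducibles})"
    (is "_ = Inf (_ ` ?Fs)")
proof -
  have bdd: "bdd_below (partial_density g ` ?Fs)"
    by (rule bdd_belowI[of _ 0]) (auto simp: partial_density_nonneg)
  have "(partial_density g \<longlongrightarrow> Inf (partial_density g ` ?Fs)) (finite_subsets_at_top monic_irreducibles)"
  proof (rule order_tendstoI)
    fix a assume "a < Inf (partial_density g ` ?Fs)"
    moreover have "Inf (partial_density g ` ?Fs) \<le> partial_density g F" if "F \<in> ?Fs" for F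
      using bdd that by (intro cInf_lower) auto
    ultimately show "\<forall>\<^sub>F F in finite_subsets_at_top monic_irreducibles. a < partial_density g F"
      by (intro eventually_finite_subsets_at_top_weakI) fastforce
  next
    fix a assume "Inf (partial_density g ` ?Fs) < a"
    then obtain F where F: "F \<in> ?Fs" "partial_density g F < a"
      using cInf_lessD[of "partial_density g ` ?Fs" a] by auto
    then show "\<forall>\<^sub>F F in finite_subsets_at_top monic_irreducibles. partial_density g F < a"
      unfolding eventually_finite_subsets_at_top
      by (intro exI[of _ F]) (auto intro: le_less_trans[OF partial_density_antimono])
  qed
  then have "Lim (finite_subsets_at_top monic_irreducibles) (partial_density g) =
      Inf (partial_density g ` ?Fs)"
    by (intro tendsto_Lim) simp_all
  then show ?thesis
    by (simp add: density_const_def partial_density_def[abs_def] square_density_def)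
qed

lemma density_const_le: "finite F \<Longrightarrow> F \<subseteq> monic_irreducibles \<Longrightarrow> density_const g \<le> partial_density g F"
  unfolding density_const_eq_Inf
  by (intro cInf_lower bdd_belowI[of _ 0]) (auto simp: partial_density_nonneg)

lemma sum_square_density_le:
  fixes g :: "'a::finite_field poly poly"
  assumes rho: "\<And>P. P \<in> monic_irreducibles \<Longrightarrow> degree P > d \<Longrightarrow> rho g (P\<^sup>2) \<le> degree g"
    and F: "finite F" "F \<subseteq> monic_irreducibles" "\<And>P. P \<in> F \<Longrightarrow> degree P > d"
  shows "(\<Sum>P\<in>F. square_density g P) \<le> real (degree g) / real (CARD('a)) ^ d"
proof -
  have "(\<Sum>P\<in>F. square_density g P) \<le> (\<Sum>P\<in>F. real (degree g) * (1 / real (poly_norm P) ^ 2))"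
  proof (rule sum_mono)
    fix P assume "P \<in> F"
    then have "rho g (P\<^sup>2) \<le> degree g" using rho F by blast
    then show "square_density g P \<le> real (degree g) * (1 / real (poly_norm P) ^ 2)"
      by (simp add: square_density_def divide_right_mono)
  qed
  also have "\<dots> = real (degree g) * (\<Sum>P\<in>F. 1 / real (poly_norm P) ^ 2)"
    by (rule sum_distrib_left[symmetric])
  also have "\<dots> \<le> real (degree g) * (1 / real (CARD('a)) ^ d)"
    by (intro mult_left_mono sum_inverse_square_norm_le F) simp_all
  finally show ?thesis by simp
qed

text \<open>By the Weierstrass product inequality, the factors of degree above \<open>d\<close> cost
  at most \<open>1\<close> minus the sum of their densities. This bound is uniform in the finite set
  \<open>F\<close> and so passes to the infimum.\<close>

lemma density_const_ge:
  fixes g :: "'a::finite_field poly poly"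
  assumes rho: "\<And>P. P \<in> monic_irreducibles \<Longrightarrow> degree P > d \<Longrightarrow> rho g (P\<^sup>2) \<le> degree g"
  shows "density_const g \<ge>
    partial_density g (primes_upto d) * (1 - real (degree g) / real (CARD('a)) ^ d)"
  unfolding density_const_eq_Inf
proof (rule cInf_greatest)
  fix x assume "x \<in> partial_density g ` {F. finite F \<and> F \<subseteq> monic_irreducibles}"
  then obtain F where F: "x = partial_density g F" "finite F" "F \<subseteq> monic_irreducibles" by auto
  let ?T = "primes_upto d :: 'a poly set"
  have "(\<Sum>P\<in>F - ?T. square_density g P) \<le> real (degree g) / real (CARD('a)) ^ d"
    using F by (intro sum_square_density_le rho) (auto simp: primes_upto_def)
  moreover have "1 - (\<Sum>P\<in>F - ?T. square_density g P) \<le> partial_density g (F - ?T)"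
    unfolding partial_density_def using F square_density_bounds by (intro Weierstrass_prod_ineq) blast
  ultimately have "partial_density g ?T * (1 - real (degree g) / real (CARD('a)) ^ d) \<le>
      partial_density g ?T * partial_density g (F - ?T)"
    by (intro mult_left_mono partial_density_nonneg primes_upto_subset) linarith
  also have "\<dots> = partial_density g (?T \<union> F)"
    using F by (simp add: partial_density_Un finite_primes_upto)
  also have "\<dots> \<le> x"
    using F finite_primes_upto primes_upto_subset unfolding F(1)
    by (intro partial_density_antimono) auto
  finally show "partial_density g ?T * (1 - real (degree g) / real (CARD('a)) ^ d) \<le> x" .
qed blast

section \<open>Upper and lower bounds for the number of square-free values\<close>

lemma squarefree_imp_not_square_dvd:
  assumes "P \<in> monic_irreducibles" and "squarefree h"
  shows "\<not> P\<^sup>2 dvd h"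
  using assms squarefreeD[of h P] monic_irreducibles_prime_elem[OF assms(1)] by (auto simp: prime_elem_def)

lemma ex_monic_irreducible_dvd:
  fixes h :: "'a::finite_field poly"
  assumes "h \<noteq> 0" and "\<not> h dvd 1"
  shows "\<exists>P\<in>monic_irreducibles. P dvd h"
proof -
  obtain P where P: "prime_elem P" "P dvd h" using ex_prime_elem_dvd[OF assms] by blast
  then have P0: "P \<noteq> 0" by (auto simp: prime_elem_def)
  define c where "c = inverse (lead_coeff P)"
  have c0: "c \<noteq> 0" using P0 by (simp add: c_def)
  have eq: "smult c P = [:c:] * P" by simp
  have "irreducible (smult c P)"
    unfolding eq using P(1) c0
    by (subst irreducible_mult_unit_left) (auto simp: is_unit_const_poly_iff dvd_field_iff prime_elem_imp_irreducible)
  then have "smult c P \<in> monic_irreducibles" using P0 by (simp add: monic_irreducibles_def c_def)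
  moreover have "smult c P dvd h" using P(2) c0 by (simp add: smult_dvd_iff)
  ultimately show ?thesis by blast
qed

lemma squarefree_if_not_square_dvd:
  fixes h :: "'a::finite_field poly"
  assumes "\<And>P. P \<in> monic_irreducibles \<Longrightarrow> \<not> P\<^sup>2 dvd h"
  shows "squarefree h"
proof (rule squarefreeI)
  fix x assume x: "x\<^sup>2 dvd h"
  show "x dvd 1"
  proof (rule ccontr)
    assume nu: "\<not> x dvd 1"
    have "\<exists>P\<in>monic_irreducibles. P dvd x"
    proof (cases "x = 0")
      \<comment> \<open>Here \<open>h = 0\<close>: every monic irreducible divides \<open>x\<close>,
        and the non-unit \<open>t\<close> guarantees that there is one.\<close>
      case True
      have "\<not> [:0, 1:] dvd (1 :: 'a poly)" by (simp add: is_unit_iff_degree)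
      then obtain P where "P \<in> (monic_irreducibles :: 'a poly set)"
        using ex_monic_irreducible_dvd[of "[:0, 1:]"] by auto
      then show ?thesis using True by auto
    qed (use nu ex_monic_irreducible_dvd in auto)
    then obtain P where "P \<in> monic_irreducibles" "P\<^sup>2 dvd h"
      using x by (meson dvd_power_same dvd_trans)
    then show False using assms by blast
  qed
qed

lemma card_squarefree_le:
  fixes g :: "'a::finite_field poly poly"
  assumes "degree (\<Prod>P\<in>primes_upto d. (P :: 'a poly)\<^sup>2) \<le> m"
  shows "real (card {b \<in> short_interval N m. squarefree (poly g b)}) \<le>
    real (CARD('a)) ^ m * partial_density g (primes_upto d)"
proof -
  have "card {b \<in> short_interval N m. squarefree (poly g b)} \<le>
      card {b \<in> short_interval N m. \<forall>P\<in>primes_upto d. \<not> P\<^sup>2 dvd poly g b}"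
    using primes_upto_subset squarefree_imp_not_square_dvd
    by (intro card_mono) (auto simp: finite_short_interval)
  then show ?thesis
    using card_short_interval_sieve[OF finite_primes_upto primes_upto_subset assms, of N g]
    by (simp add: partial_density_def square_density_def)
qed

lemma card_square_dvd:
  fixes g :: "'a::finite_field poly poly"
  assumes P: "P \<in> monic_irreducibles" and "2 * degree P \<le> m"
  shows "real (card {b \<in> short_interval N m. P\<^sup>2 dvd poly g b}) =
    real (CARD('a)) ^ m * square_density g P"
proof -
  have P0: "P\<^sup>2 \<noteq> 0" and deg: "degree (P\<^sup>2) = 2 * degree P"
    using monic_irreducibles_nonzero[OF P] by (simp_all add: degree_power_eq)
  have "card {b \<in> short_interval N m. P\<^sup>2 dvd poly g b} =
      CARD('a) ^ (m - degree (P\<^sup>2)) * card {r \<in> deg_less (degree (P\<^sup>2)). P\<^sup>2 dvd poly g r}"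
  proof (rule card_short_interval_periodic[OF P0])
    show "degree (P\<^sup>2) \<le> m" using assms(2) deg by simp
    fix a b assume "P\<^sup>2 dvd a - b"
    then have "P\<^sup>2 dvd poly g a - poly g b" using diff_dvd_poly_diff dvd_trans by blast
    then show "P\<^sup>2 dvd poly g a \<longleftrightarrow> P\<^sup>2 dvd poly g b" by (metis diff_eq_eq dvd_add_right_iff)
  qed
  also have "\<dots> = CARD('a) ^ (m - 2 * degree P) * rho g (P\<^sup>2)" using P0 by (simp add: rho_eq deg)
  finally have eq: "card {b \<in> short_interval N m. P\<^sup>2 dvd poly g b} =
    CARD('a) ^ (m - 2 * degree P) * rho g (P\<^sup>2)" .
  have "real (CARD('a)) ^ m = real (CARD('a)) ^ (m - 2 * degree P) * real (poly_norm P) ^ 2"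
    using assms(2) by (simp add: poly_norm_def flip: power_mult power_add)
  moreover have "real (poly_norm P) \<noteq> 0" by (simp add: poly_norm_def)
  ultimately show ?thesis by (simp add: eq square_density_def)
qed

text \<open>A survivor of the sieve up to degree \<open>d\<close> that is not square-free has a
  square divisor either from the middle range \<open>?M\<close>, where the union bound sums exact
  counts, or from the large primes, which stay as a separate term.\<close>

lemma card_squarefree_ge:
  fixes g :: "'a::finite_field poly poly"
  assumes deg: "degree (\<Prod>P\<in>primes_upto d. (P :: 'a poly)\<^sup>2) \<le> m"
    and rho: "\<And>P. P \<in> monic_irreducibles \<Longrightarrow> degree P > d \<Longrightarrow> rho g (P\<^sup>2) \<le> degree g"
  shows "real (card {b \<in> short_interval N m. squarefree (poly g b)}) \<ge>
    real (CARD('a)) ^ m * (partial_density g (primes_upto d) - real (degree g) / real (CARD('a)) ^ d)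
    - real (card {b \<in> short_interval N m. large_square_divisor g m b})"
proof -
  let ?I = "short_interval N m" and ?q = "real (CARD('a))"
  let ?A = "{b \<in> ?I. \<forall>P\<in>primes_upto d. \<not> P\<^sup>2 dvd poly g b}"
  let ?M = "{P \<in> monic_irreducibles. d < degree P \<and> 2 * degree P \<le> m} :: 'a poly set"
  let ?B = "\<lambda>P. {b \<in> ?I. P\<^sup>2 dvd poly g b}"
  let ?L = "{b \<in> ?I. large_square_divisor g m b}" and ?S = "{b \<in> ?I. squarefree (poly g b)}"
  have finM: "finite ?M" by (rule finite_subset[OF _ finite_primes_upto[of m]]) (auto simp: primes_upto_def)
  have "?A \<subseteq> ?S \<union> (\<Union>P\<in>?M. ?B P) \<union> ?L"
  proof
    fix b assume b: "b \<in> ?A"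
    show "b \<in> ?S \<union> (\<Union>P\<in>?M. ?B P) \<union> ?L"
    proof (cases "squarefree (poly g b)")
      case False
      then obtain P where P: "P \<in> monic_irreducibles" "P\<^sup>2 dvd poly g b"
        using squarefree_if_not_square_dvd by blast
      then have "d < degree P" using b by (auto simp: primes_upto_def not_le)
      then show ?thesis using b P by (cases "2 * degree P \<le> m") (auto simp: large_square_divisor_def not_le)
    qed (use b in auto)
  qed
  then have "card ?A \<le> card (?S \<union> (\<Union>P\<in>?M. ?B P) \<union> ?L)"
    using finM by (intro card_mono) (auto simp: finite_short_interval)
  also have "\<dots> \<le> card ?S + card (\<Union>P\<in>?M. ?B P) + card ?L"
    by (meson card_Un_le le_trans add_le_mono1)
  also have "card (\<Union>P\<in>?M. ?B P) \<le> (\<Sum>P\<in>?M. card (?B P))" by (rule card_UN_le[OF finM])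
  finally have "real (card ?A) \<le> real (card ?S) + (\<Sum>P\<in>?M. real (card (?B P))) + real (card ?L)"
    by (simp flip: of_nat_add of_nat_sum)
  also have "(\<Sum>P\<in>?M. real (card (?B P))) = ?q ^ m * (\<Sum>P\<in>?M. square_density g P)"
    unfolding sum_distrib_left by (rule sum.cong) (auto simp: card_square_dvd)
  also have "\<dots> \<le> ?q ^ m * (real (degree g) / ?q ^ d)"
    using finM by (intro mult_left_mono sum_square_density_le rho) auto
  finally have "real (card ?A) \<le> real (card ?S) + ?q ^ m * (real (degree g) / ?q ^ d) + real (card ?L)"
    by simp
  moreover have "real (card ?A) = ?q ^ m * partial_density g (primes_upto d)"
    using card_short_interval_sieve[OF finite_primes_upto primes_upto_subset deg, of N g]
    by (simp add: partial_density_def square_density_def)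
  ultimately show ?thesis by (simp add: right_diff_distrib)
qed

subsection \<open>Asymptotics\<close>

text \<open>With \<open>u\<close> the logarithm of \<open>n\<close> to base \<open>q\<close> and
  \<open>w\<close> the expression tending to infinity, \<open>q powr (m / p)\<close> equals
  \<open>n / u * q powr (w / p)\<close>. Once \<open>m \<ge> u\<close>, the quotient is therefore at
  most \<open>q powr (- w / p)\<close>.\<close>

lemma growth_condition:
  fixes q p :: nat and n m :: "nat \<Rightarrow> nat"
  assumes q: "q \<ge> 2" and p: "p \<ge> 2" and n: "\<And>j. n j \<ge> q"
    and lim: "filterlim
      (\<lambda>j. real (m j) - real p * (log (real q) (real (n j)) - log (real q) (log (real q) (real (n j)))))
      at_top sequentially"
  shows "filterlim m at_top sequentially"
    and "(\<lambda>j. real (n j) / (real (m j) * real q powr (real (m j) / real p))) \<longlonglongrightarrow> 0"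
proof -
  define u where "u j = log (real q) (real (n j))" for j
  define w where "w j = real (m j) - real p * (u j - log (real q) (u j))" for j
  have w: "filterlim w at_top sequentially" using lim by (simp add: w_def[abs_def] u_def)
  have u1: "u j \<ge> 1" for j
    using q n[of j] by (simp add: u_def le_log_iff)
  \<comment> \<open>The slope \<open>1 / 2\<close> makes \<open>p * (u - log u)\<close> at least
    \<open>u - 2 * p\<close> for \<open>p \<ge> 2\<close>. It comes from
    \<open>ln x \<le> x - 1\<close> at \<open>x = u / 4\<close> and
    \<open>ln 2 \<ge> 1 / 2\<close>.\<close>
  have log_u: "log (real q) (u j) \<le> u j / 2 + 2" for j
  proof -
    have "ln (u j / 4) \<le> u j / 4 - 1" using u1[of j] by (intro ln_le_minus_one) simp
    moreover have "ln (u j / 4) = ln (u j) - 2 * ln 2"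
      using u1[of j] ln_realpow[of 2 2] by (simp add: ln_div)
    ultimately have 1: "ln (u j) \<le> u j / 4 + 2 * ln 2" by simp
    have ln2: "ln 2 \<ge> (1/2 :: real)" using ln2_ge_two_thirds by simp
    have "u j / 4 \<le> u j / 2 * ln 2" using ln2 u1[of j] mult_left_mono[OF ln2, of "u j / 2"] by simp
    then have "ln (u j) \<le> (u j / 2 + 2) * ln 2" using 1 by (simp add: algebra_simps)
    also have "\<dots> \<le> (u j / 2 + 2) * ln (real q)" using u1[of j] q by (intro mult_left_mono) auto
    finally show ?thesis using q by (simp add: log_def field_simps)
  qed
  have m_ge: "real (m j) \<ge> u j + (w j - 2 * real p)" for j
  proof -
    have "real p * (u j - log (real q) (u j)) \<ge> real p * (u j / 2 - 2)"
      using log_u[of j] by (intro mult_left_mono) auto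
    moreover have "real p * (u j / 2) \<ge> 2 * (u j / 2)" using p u1[of j] by (intro mult_right_mono) auto
    ultimately show ?thesis by (simp add: w_def algebra_simps)
  qed
  have "filterlim (\<lambda>j. - 2 * real p + w j) at_top sequentially"
    by (rule filterlim_tendsto_add_at_top[OF tendsto_const w])
  then have "filterlim (\<lambda>j. real (m j)) at_top sequentially"
    by (rule filterlim_at_top_mono) (use m_ge u1 in \<open>auto intro!: always_eventually simp: algebra_simps\<close>, smt (verit))
  then show "filterlim m at_top sequentially"
    by (simp add: filterlim_sequentially_iff_filterlim_real)
  have pow: "real q powr (real (m j) / real p) = real (n j) / u j * real q powr (w j / real p)" for j
  proof -
    have "real (m j) / real p = (u j - log (real q) (u j)) + w j / real p"
      using p by (simp add: w_def field_simps)
    then have "real q powr (real (m j) / real p) =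
        real q powr u j / real q powr log (real q) (u j) * real q powr (w j / real p)"
      by (simp add: powr_add powr_diff)
    then show ?thesis using q n[of j] u1[of j] by (simp add: u_def)
  qed
  \<comment> \<open>The condition on \<open>w\<close> is what turns \<open>m_ge\<close> into
    \<open>m j \<ge> u j\<close>.\<close>
  have bound: "real (n j) / (real (m j) * real q powr (real (m j) / real p)) \<le> real q powr (- (w j / real p))"
    if "w j \<ge> 2 * real p" for j
  proof -
    have mu: "real (m j) \<ge> u j" using m_ge[of j] that by simp
    have n0: "real (n j) > 0" using n[of j] q by simp
    have "real (n j) * real q powr (w j / real p) = u j * (real (n j) / u j * real q powr (w j / real p))"
      using u1[of j] by simp
    also have "\<dots> \<le> real (m j) * (real (n j) / u j * real q powr (w j / real p))"
      using mu u1[of j] by (intro mult_right_mono) auto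
    finally have le: "real (n j) * real q powr (w j / real p) \<le> real (m j) * real q powr (real (m j) / real p)"
      by (simp only: pow)
    have pos: "real q powr (w j / real p) > 0" using q by simp
    have "real (n j) / (real (m j) * real q powr (real (m j) / real p)) \<le>
        real (n j) / (real (n j) * real q powr (w j / real p))"
      using le n0 pos q mu u1[of j] by (intro divide_left_mono) auto
    also have "\<dots> = real q powr (- (w j / real p))" using n0 by (simp add: powr_minus divide_simps)
    finally show ?thesis .
  qed
  have "(\<lambda>j. real q powr (- (w j / real p))) \<longlonglongrightarrow> 0"
  proof -
    have "filterlim (\<lambda>j. w j * (1 / real p)) at_top sequentially"
      using p by (intro filterlim_at_top_mult_tendsto_pos[OF tendsto_const _ w]) simp
    then have "filterlim (\<lambda>j. - (w j / real p)) at_bot sequentially"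
      by (simp add: filterlim_uminus_at_bot)
    then have "filterlim (\<lambda>j. ln (real q) * (- (w j / real p))) at_bot sequentially"
      using q by (intro filterlim_tendsto_pos_mult_at_bot[OF tendsto_const]) auto
    then have "(\<lambda>j. exp (ln (real q) * (- (w j / real p)))) \<longlonglongrightarrow> 0"
      by (rule filterlim_compose[OF exp_at_bot])
    then show ?thesis using q by (simp add: powr_def mult.commute)
  qed
  moreover have "\<forall>\<^sub>F j in sequentially. w j \<ge> 2 * real p"
    using w by (simp add: filterlim_at_top)
  ultimately show "(\<lambda>j. real (n j) / (real (m j) * real q powr (real (m j) / real p))) \<longlonglongrightarrow> 0"
    by (intro tendsto_sandwich[OF _ eventually_mono[OF _ bound] tendsto_const]) simp_all
qed

text \<open>Translation by \<open>1\<close> permutes the field, so summing all elements shows that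
  its cardinality vanishes in it, and the characteristic divides \<open>p ^ e\<close>.\<close>

lemma CHAR_eq_if_CARD_prime_power:
  assumes "prime p" and "CARD('a::finite_field) = p ^ e"
  shows "CHAR('a) = p"
proof -
  have "(\<Sum>x\<in>UNIV. x) = (\<Sum>x\<in>UNIV. x + (1 :: 'a))"
    by (rule sum.reindex_bij_witness[of _ "\<lambda>x. x + 1" "\<lambda>x. x - 1"]) auto
  then have "of_nat (CARD('a)) = (0 :: 'a)" by (simp add: sum.distrib)
  then have "CHAR('a) dvd p ^ e" by (simp only: of_nat_eq_0_iff_char_dvd assms(2))
  then have "CHAR('a) dvd p" using prime_dvd_power CHAR_prime by blast
  then show ?thesis using assms(1) primes_dvd_imp_eq CHAR_prime by blast
qed

text \<open>The counting bound is divided by \<open>Y * m * q ^ m\<close>. The lower bound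
  \<open>q powr (m / p)\<close> for \<open>Y\<close> handles the term with \<open>degree N\<close>;
  the upper bound \<open>Y * q ^ (m div 2) \<le> q ^ m\<close> handles the fibres over the roots of
  \<open>S\<close>.\<close>

lemma large_square_divisor_negligible:
  fixes g :: "'a::finite_field poly poly" and N :: "nat \<Rightarrow> 'a poly"
  defines "q \<equiv> CARD('a)" and "p \<equiv> CHAR('a)"
  assumes "squarefree g" and m: "filterlim m at_top sequentially"
    and n: "(\<lambda>j. real (degree (N j)) / (real (m j) * real q powr (real (m j) / real p))) \<longlonglongrightarrow> 0"
  shows "(\<lambda>j. real (card {b \<in> short_interval (N j) (m j). large_square_divisor g (m j) b}) / real q ^ m j)
    \<longlonglongrightarrow> 0"
proof -
  have g0: "g \<noteq> 0" using assms(3) by auto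
  have q2: "real q \<ge> 2" using CARD_field_ge_2[where 'a='a] by (simp add: q_def)
  have p2: "p \<ge> 2" unfolding p_def using prime_ge_2_nat CHAR_prime by blast
  obtain S where S: "eliminates S g" using ex_eliminates_squarefree[OF assms(3)] by blast
  obtain C where C: "\<And>\<beta>. degree (poly S \<beta>) \<le> C * (degree \<beta> + 1)"
    using ex_degree_poly_bound[of S] by blast
  define K where "K = real (2 * degree g * C)"
  define bad where "bad j = real (card {b \<in> short_interval (N j) (m j). large_square_divisor g (m j) b})" for j
  define Y where "Y j = card (frobenius_roots (m j) :: 'a poly set)" for j
  have Y: "Y j = q ^ ((m j + p - 1) div p)" for j
    by (simp add: Y_def frobenius_roots_def card_deg_less q_def p_def)
  have Y_lower: "real (Y j) \<ge> real q powr (real (m j) / real p)" for j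
  proof -
    have "p * ((m j + p - 1) div p) + (m j + p - 1) mod p = m j + p - 1" by simp
    moreover have "(m j + p - 1) mod p < p" using p2 by simp
    ultimately have "m j \<le> p * ((m j + p - 1) div p)" by linarith
    then have "real (m j) / real p \<le> real ((m j + p - 1) div p)"
      using p2 by (simp add: divide_le_eq mult.commute flip: of_nat_mult)
    then have "real q powr (real (m j) / real p) \<le> real q powr real ((m j + p - 1) div p)"
      using q2 by (intro powr_mono) auto
    then show ?thesis using q2 by (simp add: Y powr_realpow)
  qed
  have Y_upper: "real (Y j) * real q ^ (m j div 2) \<le> real q ^ m j" if "m j > 0" for j
  proof -
    \<comment> \<open>For \<open>m > 0\<close> and \<open>p \<ge> 2\<close> the ceiling of
      \<open>m / p\<close> is at most \<open>(m - 1) div 2 + 1\<close>, and adding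
      \<open>m div 2\<close> to that gives exactly \<open>m\<close>.\<close>
    have "(m j + p - 1) div p + m j div 2 \<le> m j"
    proof -
      have "(m j + p - 1) div p = (m j - 1) div p + 1"
      proof -
        have "m j + p - 1 = (m j - 1) + p" using that by linarith
        moreover have "((m j - 1) + p) div p = (m j - 1) div p + 1" using p2 by (intro div_add_self2) simp
        ultimately show ?thesis by (simp only:)
      qed
      also have "(m j - 1) div p \<le> (m j - 1) div 2" using p2 by (intro div_le_mono2) auto
      finally show ?thesis using that by linarith
    qed
    then have "real q ^ ((m j + p - 1) div p + m j div 2) \<le> real q ^ m j"
      using q2 by (intro power_increasing) auto
    then show ?thesis by (simp add: Y power_add)
  qed
  have le: "bad j / real q ^ m j \<le> K * (real (degree (N j)) / (real (m j) * real q powr (real (m j) / real p))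
      + 2 / real (Y j)) + real (degree S) / real q ^ (m j div 2)"
    if m_pos: "m j > 0" and m_ge: "m j \<ge> 2 * degree (lead_coeff g)" for j
  proof -
    let ?y = "real (Y j)" and ?m = "real (m j)" and ?Q = "real q ^ m j" and ?n = "real (degree (N j))"
    have y0: "?y > 0" using q2 by (simp add: Y)
    have Q0: "?Q > 0" using q2 by simp
    have m0: "?m \<ge> 1" using m_pos by simp
    have nat_le: "Y j * m j * card {b \<in> short_interval (N j) (m j). large_square_divisor g (m j) b} \<le>
        q ^ m j * (2 * degree g * C * (max (degree (N j)) (m j) + 1)) + m j * degree S * Y j ^ 2"
      unfolding Y_def q_def using card_large_square_divisor_le[OF S m_ge m_pos C g0] .
    have "?y * ?m * bad j \<le> ?Q * (K * real (max (degree (N j)) (m j) + 1)) + ?m * real (degree S) * ?y ^ 2"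
      using of_nat_mono[OF nat_le, where 'a = real]
      by (simp only: bad_def K_def of_nat_mult of_nat_add of_nat_power of_nat_1)
    \<comment> \<open>Since \<open>m \<ge> 1\<close>, \<open>max n m + 1\<close> is at most
      \<open>n + 2 * m\<close>.\<close>
    also have "\<dots> \<le> ?Q * (K * (?n + 2 * ?m)) + ?m * real (degree S) * ?y ^ 2"
      using Q0 m0 by (intro add_right_mono mult_left_mono) (auto simp: K_def)
    finally have 1: "?y * ?m * bad j \<le> ?Q * (K * (?n + 2 * ?m)) + ?m * real (degree S) * ?y ^ 2" .
    have "bad j / ?Q = (?y * ?m * bad j) / (?y * ?m * ?Q)" using y0 m0 by simp
    also have "\<dots> \<le> (?Q * (K * (?n + 2 * ?m)) + ?m * real (degree S) * ?y ^ 2) / (?y * ?m * ?Q)"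
      using 1 y0 m0 Q0 by (intro divide_right_mono) auto
    also have "\<dots> = K * (?n / (?m * ?y) + 2 / ?y) + real (degree S) * (?y / ?Q)"
      using y0 m0 Q0 by (simp add: field_simps power2_eq_square)
    also have "?n / (?m * ?y) \<le> ?n / (?m * real q powr (?m / real p))"
      using Y_lower[of j] m0 q2 y0 by (intro divide_left_mono mult_left_mono mult_pos_pos) auto
    also have "?y / ?Q \<le> 1 / real q ^ (m j div 2)"
      using Y_upper[OF m_pos] Q0 q2 by (simp add: field_simps)
    finally show ?thesis by (simp add: K_def mult_left_mono add_mono)
  qed
  have m_real: "filterlim (\<lambda>j. real (m j)) at_top sequentially"
    using m by (rule filterlim_compose[OF filterlim_real_sequentially])
  have inv_pow: "(\<lambda>j. 1 / real q ^ f j) \<longlonglongrightarrow> 0" if f: "filterlim f at_top sequentially" for f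
  proof -
    have "(\<lambda>i. (1 / real q) ^ i) \<longlonglongrightarrow> 0" using q2 by (intro LIMSEQ_realpow_zero) auto
    from filterlim_compose[OF this f] show ?thesis by (simp add: power_one_over)
  qed
  have half: "filterlim (\<lambda>j. m j div k) at_top sequentially" if "k > 0" for k
    unfolding filterlim_at_top
  proof
    fix Z
    have "\<forall>\<^sub>F j in sequentially. Z * k \<le> m j" using m by (simp add: filterlim_at_top)
    then show "\<forall>\<^sub>F j in sequentially. Z \<le> m j div k"
      by eventually_elim (use that in \<open>simp add: less_eq_div_iff_mult_less_eq\<close>)
  qed
  have "filterlim (\<lambda>j. (m j + p - 1) div p) at_top sequentially"
    by (rule filterlim_at_top_mono[OF half[of p]])
       (use p2 in \<open>auto intro!: always_eventually div_le_mono\<close>)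
  from inv_pow[OF this] have Ylim: "(\<lambda>j. 1 / real (Y j)) \<longlonglongrightarrow> 0" by (simp add: Y)
  define R where "R j = K * (real (degree (N j)) / (real (m j) * real q powr (real (m j) / real p))
      + 2 * (1 / real (Y j))) + real (degree S) * (1 / real q ^ (m j div 2))" for j
  have "R \<longlonglongrightarrow> K * (0 + 2 * 0) + real (degree S) * 0"
    unfolding R_def[abs_def] by (intro tendsto_intros n Ylim inv_pow half) simp
  then have lim: "R \<longlonglongrightarrow> 0" by simp
  have "\<forall>\<^sub>F j in sequentially. m j \<ge> max 1 (2 * degree (lead_coeff g))"
    using m unfolding filterlim_at_top by blast
  then have upper: "\<forall>\<^sub>F j in sequentially. bad j / real q ^ m j \<le> R j"
  proof eventually_elim
    case (elim j)
    then show ?case using le[of j] by (simp add: R_def)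
  qed
  have "\<forall>\<^sub>F j in sequentially. 0 \<le> bad j / real q ^ m j"
    by (simp add: bad_def)
  then have "(\<lambda>j. bad j / real q ^ m j) \<longlonglongrightarrow> 0"
    using upper tendsto_const lim by (rule tendsto_sandwich)
  then show ?thesis by (simp only: bad_def)
qed

text \<open>The cut-off \<open>d\<close> is fixed before \<open>j\<close> grows, so the degree of
  the finite sieve modulus is eventually at most \<open>m j\<close>. Then the normalised count lies
  in \<open>[?c - ?k - ?E j, ?c]\<close> and the constant in \<open>[?c - ?k, ?c]\<close>, with
  \<open>?k\<close> and \<open>?E j\<close> each below \<open>\<epsilon> / 2\<close>.\<close>

lemma card_squarefree_tendsto:
  fixes g :: "'a::finite_field poly poly" and N :: "nat \<Rightarrow> 'a poly"
  defines "q \<equiv> CARD('a)" and "p \<equiv> CHAR('a)"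
  assumes "squarefree g" and m: "filterlim m at_top sequentially"
    and n: "(\<lambda>j. real (degree (N j)) / (real (m j) * real q powr (real (m j) / real p))) \<longlonglongrightarrow> 0"
  shows "(\<lambda>j. real (card {b \<in> short_interval (N j) (m j). squarefree (poly g b)}) / real q ^ m j)
    \<longlonglongrightarrow> density_const g"
proof (rule LIMSEQ_I)
  fix \<epsilon> :: real assume \<epsilon>: "\<epsilon> > 0"
  let ?X = "\<lambda>j. real (card {b \<in> short_interval (N j) (m j). squarefree (poly g b)}) / real q ^ m j"
  let ?E = "\<lambda>j. real (card {b \<in> short_interval (N j) (m j). large_square_divisor g (m j) b}) / real q ^ m j"
  have q2: "real q \<ge> 2" using CARD_field_ge_2[where 'a='a] by (simp add: q_def)
  obtain d1 where d1: "\<forall>P\<in>monic_irreducibles. degree P \<ge> d1 \<longrightarrow> rho g (P\<^sup>2) \<le> degree g"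
    using rho_square_le_degree[OF assms(3)] by blast
  have "(\<lambda>d. real (degree g) * (1 / real q) ^ d) \<longlonglongrightarrow> real (degree g) * 0"
    using q2 by (intro tendsto_intros LIMSEQ_realpow_zero) auto
  then have "\<forall>\<^sub>F d in sequentially. real (degree g) * (1 / real q) ^ d < \<epsilon> / 2"
    using \<epsilon> by (intro order_tendstoD(2)) auto
  then have "\<forall>\<^sub>F d in sequentially. d \<ge> d1 \<and> real (degree g) * (1 / real q) ^ d < \<epsilon> / 2"
    using eventually_ge_at_top by (rule eventually_conj[rotated])
  then obtain d where d: "d \<ge> d1" "real (degree g) / real q ^ d < \<epsilon> / 2"
    using eventually_happens'[OF sequentially_bot] by (fastforce simp: power_one_over)
  let ?c = "partial_density g (primes_upto d)" and ?k = "real (degree g) / real q ^ d"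
  have rho: "rho g (P\<^sup>2) \<le> degree g" if "P \<in> monic_irreducibles" "degree P > d" for P
    using d1 d that by auto
  have c1: "?c - ?k \<le> density_const g"
  proof -
    have "?c * ?k \<le> ?k"
      by (intro mult_left_le_one_le partial_density_le_1 partial_density_nonneg primes_upto_subset) simp
    moreover have "?c * (1 - ?k) \<le> density_const g"
      unfolding q_def by (intro density_const_ge rho)
    ultimately show ?thesis by (simp only: right_diff_distrib)
  qed
  have c2: "density_const g \<le> ?c"
    by (intro density_const_le finite_primes_upto primes_upto_subset)
  have "?E \<longlonglongrightarrow> 0"
    using large_square_divisor_negligible[OF assms(3) m] n by (simp add: q_def p_def)
  then have "\<forall>\<^sub>F j in sequentially. ?E j < \<epsilon> / 2"
    using \<epsilon> by (intro order_tendstoD(2)) auto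
  moreover have "\<forall>\<^sub>F j in sequentially. m j \<ge> degree (\<Prod>P\<in>primes_upto d. (P :: 'a poly)\<^sup>2)"
    using m by (simp add: filterlim_at_top)
  ultimately have "\<forall>\<^sub>F j in sequentially. norm (?X j - density_const g) < \<epsilon>"
  proof eventually_elim
    case (elim j)
    let ?Q = "real q ^ m j"
    have Q0: "?Q > 0" using q2 by simp
    have "?X j \<le> ?c"
      using card_squarefree_le[OF elim(2), of "N j" g] Q0
      by (simp add: q_def divide_le_eq mult.commute)
    moreover have "?X j \<ge> ?c - ?k - ?E j"
    proof -
      have "(?Q * (?c - ?k) - real (card {b \<in> short_interval (N j) (m j). large_square_divisor g (m j) b})) / ?Q
          \<le> ?X j"
        using card_squarefree_ge[OF elim(2) rho, of "N j"] Q0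
        by (intro divide_right_mono) (auto simp: q_def)
      moreover have "q \<noteq> 0" using q2 by (cases q) auto
      ultimately show ?thesis by (simp add: diff_divide_distrib)
    qed
    ultimately show ?case using c1 c2 d(2) elim(1) by (simp add: abs_less_iff)
  qed
  then show "\<exists>j0. \<forall>j\<ge>j0. norm (?X j - density_const g) < \<epsilon>"
    by (simp add: eventually_sequentially)
qed

text \<open>Asymptotic equivalence with \<open>0\<close> means being eventually \<open>0\<close>, so the case of a vanishing
  constant does not follow from the limit of the normalised counts.\<close>

lemma card_squarefree_eq_0_if_density_const_eq_0:
  fixes g :: "'a::finite_field poly poly"
  assumes "squarefree g" and "density_const g = 0"
  shows "\<exists>m0. \<forall>m\<ge>m0. \<forall>N. card {b \<in> short_interval N m. squarefree (poly g b)} = 0"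
proof -
  have q2: "real (CARD('a)) \<ge> 2" using CARD_field_ge_2[where 'a='a] by simp
  obtain d1 where d1: "\<forall>P\<in>monic_irreducibles. degree P \<ge> d1 \<longrightarrow> rho g (P\<^sup>2) \<le> degree g"
    using rho_square_le_degree[OF assms(1)] by blast
  \<comment> \<open>This \<open>d\<close> gives \<open>degree g < q ^ d\<close>, so the factor in
    \<open>density_const_ge\<close> is positive. A vanishing constant then forces a finite partial
    product to vanish, and the upper bound for the count becomes \<open>0\<close>.\<close>
  define d where "d = d1 + degree g"
  have "real (degree g) < 2 ^ degree g" by (rule of_nat_less_two_power)
  also have "\<dots> \<le> 2 ^ d" by (simp add: d_def)
  also have "\<dots> \<le> real (CARD('a)) ^ d" using q2 by (intro power_mono) auto
  finally have "1 - real (degree g) / real (CARD('a)) ^ d > 0" by (simp add: field_simps)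
  moreover have "partial_density g (primes_upto d) * (1 - real (degree g) / real (CARD('a)) ^ d) \<le> 0"
    unfolding assms(2)[symmetric] using d1 by (intro density_const_ge) (auto simp: d_def)
  ultimately have "partial_density g (primes_upto d) \<le> 0"
    by (metis mult_le_0_iff not_less)
  then have "partial_density g (primes_upto d) = 0"
    by (intro antisym partial_density_nonneg primes_upto_subset)
  then have "card {b \<in> short_interval N m. squarefree (poly g b)} = 0"
    if "m \<ge> degree (\<Prod>P\<in>primes_upto d. (P :: 'a poly)\<^sup>2)" for m and N :: "'a poly"
    using card_squarefree_le[OF that, of N g] by simp
  then show ?thesis by blast
qed

theorem theorem2p4:
  fixes g :: "'a::finite_field poly poly"
    and p e q k :: nat
    and n m :: "nat \<Rightarrow> nat"
    and N :: "nat \<Rightarrow> 'a poly"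
  assumes "prime p" and "e \<ge> 1" and "q = p ^ e" and "CARD('a) = q"
    and "squarefree g" and "degree g = k"
    and "\<And>j. n j \<ge> q" and "\<And>j. m j > 0"
    and "filterlim
           (\<lambda>j. real (m j) - real p * (log (real q) (real (n j)) - log (real q) (log (real q) (real (n j)))))
           at_top sequentially"
    and "\<And>j. degree (N j) = n j"
  shows "(\<lambda>j. real (card {b \<in> short_interval (N j) (m j). squarefree (poly g b)}))
           \<sim>[sequentially] (\<lambda>j. density_const g * real q ^ m j)"
proof -
  let ?X = "\<lambda>j. real (card {b \<in> short_interval (N j) (m j). squarefree (poly g b)})"
  have p: "CHAR('a) = p"
    using CHAR_eq_if_CARD_prime_power[of p e, where 'a = 'a] assms(1,3,4) by simp
  have q: "q = CARD('a)" "q \<ge> 2" using assms(4) CARD_field_ge_2[where 'a = 'a] by simp_all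
  have m: "filterlim m at_top sequentially"
    and n: "(\<lambda>j. real (n j) / (real (m j) * real q powr (real (m j) / real p))) \<longlonglongrightarrow> 0"
    using growth_condition[OF q(2) prime_ge_2_nat[OF assms(1)] assms(7,9)] by auto
  show ?thesis
  proof (cases "density_const g = 0")
    case True
    obtain m0 where m0: "\<And>m N. m \<ge> m0 \<Longrightarrow> card {b \<in> short_interval N m. squarefree (poly g b)} = 0"
      using card_squarefree_eq_0_if_density_const_eq_0[OF assms(5) True] by blast
    have "\<forall>\<^sub>F j in sequentially. m j \<ge> m0"
      using m unfolding filterlim_at_top by blast
    then have "\<forall>\<^sub>F j in sequentially. ?X j = density_const g * real q ^ m j"
      by eventually_elim (simp add: m0 True)
    then show ?thesis by (rule asymp_equiv_refl_ev)
  next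
    case False
    have "(\<lambda>j. ?X j / real q ^ m j) \<longlonglongrightarrow> density_const g"
      using card_squarefree_tendsto[OF assms(5) m, of N] n by (simp add: p q(1) assms(10))
    then show ?thesis using False by (rule asymp_equivI'_const)
  qed
qed

end
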